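(* \textsc{Strong Triadic Closure} parameterized by $\ell:=|E|-k$ admits a problem kernel with $\mathcal{O}(\ell\cdot 2^{\ell})$ vertices that can be computed in $\mathcal{O}(\sqrt{n}\,m)$ time, where $n$ and $m$ are the numbers of vertices and edges of the input graph.
   Context: All graphs are finite, undirected and simple. A labeling of $G=(V,E)$ is a partition $(S_L,W_L)$ of $E$ into strong and weak edges; it is an STC-labeling if there are no strong edges $\{u,v\},\{v,w\}\in S_L$ with $\{u,w\}\notin E$. \textsc{Strong Triadic Closure}: given $G=(V,E)$ and $k\in\mathbb{N}$, decide whether $G$ has an STC-labeling with $|W_L|\le k$; the parameter is $\ell=|E|-k$, the required number of strong edges. A problem kernel for parameter $\ell$ is a polynomial-time algorithm mapping an instance to an equivalent instance whose parameter is at most $\ell$ and whose size (here: number of vertices) is bounded by a function of $\ell$. *)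

theory Defs
  imports Complex_Main "HOL-Library.Landau_Symbols"
begin

section \<open>Strong triadic closure\<close>

definition simple_graph :: "'a set \<Rightarrow> 'a set set \<Rightarrow> bool" where
  "simple_graph V E \<longleftrightarrow> finite V \<and> (\<forall>e\<in>E. e \<subseteq> V \<and> card e = 2)"

text \<open>Without \<open>u \<noteq> w\<close> a single strong edge, read as \<open>{u,v}\<close> and \<open>{v,u}\<close>, would already be a
  violation.\<close>

definition stc_labeling :: "'a set set \<Rightarrow> 'a set set \<Rightarrow> 'a set set \<Rightarrow> bool" where
  "stc_labeling E S W \<longleftrightarrow> S \<union> W = E \<and> S \<inter> W = {} \<and>
     \<not> (\<exists>u v w. u \<noteq> w \<and> {u, v} \<in> S \<and> {v, w} \<in> S \<and> {u, w} \<notin> E)"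

definition STC :: "'a set set \<Rightarrow> nat \<Rightarrow> bool" where
  "STC E k \<longleftrightarrow> (\<exists>S W. stc_labeling E S W \<and> card W \<le> k)"

text \<open>The subtraction is truncated: instances with \<open>k > card E\<close> (which are trivial yes-instances)
  get parameter 0.\<close>

definition ell :: "'a set set \<Rightarrow> nat \<Rightarrow> nat" where
  "ell E k = card E - k"

section \<open>Random access machine\<close>

text \<open>
  Time is measured on a random access machine whose programs are given in structured form.
  The memory consists of named arrays of natural numbers with random access; a fixed program
  uses only finitely many of them, and a scalar variable is cell 0 of an array. Every operation
  costs one unit. Neither addition nor multiplication is primitive: a computation of cost \<open>t\<close>
  produces no number exceeding the largest number in the input and in the program by more
  than \<open>t\<close>. Hence numbers in a polynomially bounded computation fit into words of logarithmic
  length and charging one unit per operation is realistic.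
\<close>

type_synonym mem = "string \<Rightarrow> nat \<Rightarrow> nat"

datatype exp = Const nat | Cell string exp | Inc exp | Monus exp exp

primrec val :: "mem \<Rightarrow> exp \<Rightarrow> nat" where
  "val s (Const c) = c"
| "val s (Cell a e) = s a (val s e)"
| "val s (Inc e) = Suc (val s e)"
| "val s (Monus e f) = val s e - val s f"

primrec cost :: "exp \<Rightarrow> nat" where
  "cost (Const c) = 1"
| "cost (Cell a e) = cost e + 1"
| "cost (Inc e) = cost e + 1"
| "cost (Monus e f) = cost e + cost f + 1"

datatype com =
    Skip
  | Store string exp exp   \<comment> \<open>\<open>Store a i e\<close> is the assignment \<open>a[i] := e\<close>\<close>
  | Seq com com
  | If exp com com   \<comment> \<open>conditions hold iff their value is nonzero\<close>
  | While exp com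

text \<open>\<open>exec p s t s'\<close>: started in memory \<open>s\<close>, program \<open>p\<close> terminates with cost \<open>t\<close> in memory \<open>s'\<close>.\<close>

inductive exec :: "com \<Rightarrow> mem \<Rightarrow> nat \<Rightarrow> mem \<Rightarrow> bool" where
  Skip: "exec Skip s 1 s"
| Store: "exec (Store a i e) s (cost i + cost e + 1) (s(a := (s a)(val s i := val s e)))"
| Seq: "exec c s t s' \<Longrightarrow> exec d s' t' s'' \<Longrightarrow> exec (Seq c d) s (t + t') s''"
| IfTrue: "val s e \<noteq> 0 \<Longrightarrow> exec c s t s' \<Longrightarrow> exec (If e c d) s (cost e + 1 + t) s'"
| IfFalse: "val s e = 0 \<Longrightarrow> exec d s t s' \<Longrightarrow> exec (If e c d) s (cost e + 1 + t) s'"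
| WhileFalse: "val s e = 0 \<Longrightarrow> exec (While e c) s (cost e + 1) s"
| WhileTrue: "val s e \<noteq> 0 \<Longrightarrow> exec c s t s' \<Longrightarrow> exec (While e c) s' t' s'' \<Longrightarrow>
    exec (While e c) s (cost e + 1 + t + t') s''"

inductive_cases SkipE: "exec Skip s t s'"
inductive_cases StoreE: "exec (Store a i e) s t s'"
inductive_cases SeqE: "exec (Seq c d) s t s'"
inductive_cases IfE: "exec (If e c d) s t s'"
inductive_cases WhileE: "exec (While e c) s t s'"

lemma exec_deterministic: "exec c s t s' \<Longrightarrow> exec c s u s'' \<Longrightarrow> t = u \<and> s' = s''"
proof (induction arbitrary: u s'' rule: exec.induct)
  case (Skip s)
  then show ?case by (rule SkipE) simp
next
  case (Store a i e s)
  then show ?case by (rule StoreE) simp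
next
  case (Seq c s t s1 d t' s2)
  from Seq.prems obtain t1 r t2
    where *: "u = t1 + t2" "exec c s t1 r" "exec d r t2 s''" by (rule SeqE)
  from Seq.IH(1)[OF *(2)] have "t = t1" "s1 = r" by simp_all
  with Seq.IH(2) *(1,3) show ?case by simp
next
  case (IfTrue s e c t s1 d)
  from IfTrue.prems obtain t1 where *: "u = cost e + 1 + t1" "exec c s t1 s''"
    by (rule IfE) (use IfTrue.hyps in simp_all)
  from IfTrue.IH[OF *(2)] *(1) show ?case by simp
next
  case (IfFalse s e d t s1 c)
  from IfFalse.prems obtain t1 where *: "u = cost e + 1 + t1" "exec d s t1 s''"
    by (rule IfE) (use IfFalse.hyps in simp_all)
  from IfFalse.IH[OF *(2)] *(1) show ?case by simp
next
  case (WhileFalse s e c)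
  from WhileFalse.prems show ?case by (rule WhileE) (use WhileFalse.hyps in simp_all)
next
  case (WhileTrue s e c t s1 t' s2)
  from WhileTrue.prems obtain t1 r t2
    where *: "u = cost e + 1 + t1 + t2" "exec c s t1 r" "exec (While e c) r t2 s''"
    by (rule WhileE) (use WhileTrue.hyps in simp_all)
  from WhileTrue.IH(1)[OF *(2)] have "t = t1" "s1 = r" by simp_all
  with WhileTrue.IH(2) *(1,3) show ?case by simp
qed

section \<open>Problem kernels\<close>

text \<open>An instance is stored as the number of vertices, the number of edges, \<open>k\<close>, and a
  repetition-free list of the edges in arbitrary order, the \<open>i\<close>-th edge having the endpoints
  \<open>u[i]\<close> and \<open>v[i]\<close> in arbitrary order.\<close>

definition encodes :: "mem \<Rightarrow> nat set \<Rightarrow> nat set set \<Rightarrow> nat \<Rightarrow> bool" where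
  "encodes s V E k \<longleftrightarrow>
     V = {..<s ''n'' 0} \<and>
     bij_betw (\<lambda>i. {s ''u'' i, s ''v'' i}) {..<s ''m'' 0} E \<and>
     s ''k'' 0 = k"

definition initial :: "mem \<Rightarrow> nat set \<Rightarrow> nat set set \<Rightarrow> nat \<Rightarrow> bool" where
  "initial s V E k \<longleftrightarrow> encodes s V E k \<and>
     (\<forall>a i. \<not> (a \<in> {''n'', ''m'', ''k''} \<and> i = 0) \<and>
            \<not> (a \<in> {''u'', ''v''} \<and> i < s ''m'' 0) \<longrightarrow> s a i = 0)"

text \<open>\<open>stc_kernel p g T\<close>: program \<open>p\<close> is a kernelization for Strong Triadic Closure parameterized
  by \<open>ell\<close>, with at most \<open>g(ell)\<close> vertices in the output and cost at most \<open>T n m\<close> on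
  graphs with \<open>n\<close> vertices and \<open>m\<close> edges. By \<open>exec_deterministic\<close> there is only one
  possible outcome of \<open>p\<close>.\<close>

definition stc_kernel :: "com \<Rightarrow> (nat \<Rightarrow> real) \<Rightarrow> (nat \<Rightarrow> nat \<Rightarrow> real) \<Rightarrow> bool" where
  "stc_kernel p g T \<longleftrightarrow>
     (\<forall>V E k s. simple_graph V E \<and> initial s V E k \<longrightarrow>
       (\<exists>t s' V' E' k'.
          exec p s t s' \<and> real t \<le> T (card V) (card E) \<and>
          simple_graph V' E' \<and> encodes s' V' E' k' \<and>
          (STC E k \<longleftrightarrow> STC E' k') \<and>
          ell E' k' \<le> ell E k \<and>
          real (card V') \<le> g (ell E k)))"

text \<open>The bound \<open>O(sqrt n * m)\<close>, with constant \<open>c\<close>. The maximum only matters for edgeless graphs,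
  on which no algorithm runs in zero time.\<close>

definition sqrt_time :: "real \<Rightarrow> nat \<Rightarrow> nat \<Rightarrow> real" where
  "sqrt_time c n m = c * max 1 (sqrt (real n) * real m)"

end

theory Submission
  imports Defs
begin

text \<open>
  A set of \<open>\<ell>\<close> strong edges meets every class of false twins (vertices with equal open
  neighbourhoods, hence an independent set) in at most \<open>\<ell>\<close> vertices, and false twins are
  exchangeable; so it suffices to keep \<open>\<ell>\<close> vertices of every class and to drop isolated vertices.
  Every matching is a feasible set of strong edges. If a maximum matching \<open>M\<close> has fewer than
  \<open>\<ell>\<close> edges, then by the absence of augmenting paths of length 3 the neighbourhood of an unmatched
  vertex is determined by the edges of \<open>M\<close> that it meets, so there are at most
  \<open>2 |M| + 2 ^ |M| \<le> 2 ^ (\<ell> + 1)\<close> classes. Hence no matching has to be computed: the algorithm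
  determines the classes by partition refinement along adjacency lists, answers yes if there
  are at least \<open>2 ^ (\<ell> + 2)\<close> of them, and outputs the reduced graph otherwise. It runs in time
  linear in \<open>m\<close>, and even in constant time if \<open>m \<le> k\<close>.
\<close>

section \<open>False twins and matchings\<close>

text \<open>The machine shapes the test on the number \<open>q\<close> of classes. Numbers grow by
  at most one per unit of cost, so \<open>2 ^ l\<close> is out of reach in time linear in
  \<open>m\<close> when \<open>l\<close> is large. Instead the rounded-down binary logarithm of
  \<open>q\<close> is found by counting up to \<open>q\<close>, which is at most
  \<open>2 * m\<close>. The value \<open>l + 1\<close> of this logarithm still allows
  \<open>q = 2 ^ (l + 1)\<close>, which a no-instance might attain as far as the bound goes; so yes
  is answered from \<open>l + 2\<close> on, and this produces the constant 4 in the kernel size.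

  The output budget is the number of kept edges minus \<open>l\<close>. It leaves the parameter
  unchanged only if at least \<open>l\<close> edges survive, which needs an argument of its own
  because the reduction may delete most edges.

  All working memory is initially zero and every pass runs over the edges, so neither initialization
  nor isolated vertices cost anything. A vertex turns up once per incident edge; marks make the
  repeated visits cheap, so that refinement pays for each adjacency list only once.\<close>

definition nbr :: "'a set set \<Rightarrow> 'a \<Rightarrow> 'a set" where
  "nbr E c = {x. {c, x} \<in> E}"

definition strong_set :: "'a set set \<Rightarrow> 'a set set \<Rightarrow> bool" where
  "strong_set E S \<longleftrightarrow> S \<subseteq> E \<and>
     (\<forall>u v w. u \<noteq> w \<longrightarrow> {u, v} \<in> S \<longrightarrow> {v, w} \<in> S \<longrightarrow> {u, w} \<in> E)"

definition has_strong :: "'a set set \<Rightarrow> nat \<Rightarrow> bool" where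
  "has_strong E l \<longleftrightarrow> (\<exists>S. strong_set E S \<and> card S = l)"

lemma strong_set_subset: "strong_set E S \<Longrightarrow> T \<subseteq> S \<Longrightarrow> strong_set E T"
  unfolding strong_set_def by blast

lemma has_strong_le:
  assumes "strong_set E S" "l \<le> card S"
  shows "has_strong E l"
proof -
  obtain T where "T \<subseteq> S" "card T = l"
    using obtain_subset_with_card_n[OF assms(2)] by metis
  with assms(1) show ?thesis
    unfolding has_strong_def using strong_set_subset by blast
qed

text \<open>Strong edges may be made weak without creating a violation, so exactly
  \<open>ell E k\<close> of them can be demanded. For \<open>k > card E\<close> the parameter is 0
  and the empty set serves.\<close>

lemma STC_iff_has_strong:
  assumes "finite E"
  shows "STC E k \<longleftrightarrow> has_strong E (ell E k)"
proof
  assume "STC E k"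
  then obtain S W where SW: "stc_labeling E S W" "card W \<le> k"
    unfolding STC_def by blast
  then have un: "E = S \<union> W" "S \<inter> W = {}" and st: "strong_set E S"
    unfolding stc_labeling_def strong_set_def by blast+
  have "card E = card S + card W"
    using un assms by (simp add: card_Un_disjoint)
  with SW(2) show "has_strong E (ell E k)"
    by (intro has_strong_le[OF st]) (simp add: ell_def)
next
  assume "has_strong E (ell E k)"
  then obtain S where S: "strong_set E S" "card S = card E - k"
    unfolding has_strong_def ell_def by blast
  then have sub: "S \<subseteq> E" unfolding strong_set_def by blast
  then have "card (E - S) \<le> k"
    using S(2) assms by (simp add: card_Diff_subset finite_subset)
  moreover have "stc_labeling E S (E - S)"
    using S(1) sub unfolding stc_labeling_def strong_set_def by blast
  ultimately show "STC E k" unfolding STC_def by blast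
qed

text \<open>The closure condition on \<open>S\<close> only concerns pairs of endpoints of
  \<open>S\<close>, so it suffices to control \<open>\<phi>\<close> there. It serves both for
  undoing the renaming of kept vertices and for exchanging false twins.\<close>

lemma has_strong_transfer:
  assumes S: "strong_set E S" and two: "\<And>e. e \<in> S \<Longrightarrow> card e = 2"
    and inj: "inj_on \<phi> (\<Union>S)"
    and adj: "\<And>u v. u \<in> \<Union>S \<Longrightarrow> v \<in> \<Union>S \<Longrightarrow> u \<noteq> v \<Longrightarrow> {u, v} \<in> E \<longleftrightarrow> {\<phi> u, \<phi> v} \<in> E'"
  shows "has_strong E' (card S)"
proof -
  let ?S = "(`) \<phi> ` S"
  have pair: "\<exists>u v. {u, v} \<in> S \<and> x = \<phi> u \<and> y = \<phi> v" if xy: "{x, y} \<in> ?S" for x y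
  proof -
    from xy obtain e where e: "e \<in> S" "{x, y} = \<phi> ` e" by blast
    obtain a b where ab: "e = {a, b}" using two[OF e(1)] by (auto simp: card_2_iff)
    then have "x = \<phi> a \<and> y = \<phi> b \<or> x = \<phi> b \<and> y = \<phi> a"
      using e(2) by (auto simp: doubleton_eq_iff)
    then show ?thesis using e(1) ab by (metis insert_commute)
  qed
  have "?S \<subseteq> E'"
  proof
    fix e' assume "e' \<in> ?S"
    then obtain e where e: "e \<in> S" "e' = \<phi> ` e" by blast
    obtain a b where ab: "e = {a, b}" "a \<noteq> b" using two[OF e(1)] by (auto simp: card_2_iff)
    have "{a, b} \<in> E" using e(1) ab S unfolding strong_set_def by blast
    moreover have "a \<in> \<Union>S" "b \<in> \<Union>S" using e(1) ab by blast+
    ultimately show "e' \<in> E'" using adj ab e(2) by auto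
  qed
  moreover have "{x, z} \<in> E'" if xz: "x \<noteq> z" and xy: "{x, y} \<in> ?S" and yz: "{y, z} \<in> ?S" for x y z
  proof -
    obtain u v where 1: "{u, v} \<in> S" "x = \<phi> u" "y = \<phi> v" using pair[OF xy] by blast
    obtain v' w where 2: "{v', w} \<in> S" "y = \<phi> v'" "z = \<phi> w" using pair[OF yz] by blast
    have mem: "u \<in> \<Union>S" "v \<in> \<Union>S" "v' \<in> \<Union>S" "w \<in> \<Union>S" using 1 2 by blast+
    have "v = v'" using inj_onD[OF inj] 1 2 mem by metis
    moreover have "u \<noteq> w" using xz 1 2 by blast
    ultimately have "{u, w} \<in> E" using S 1 2 unfolding strong_set_def by metis
    then show ?thesis using adj mem \<open>u \<noteq> w\<close> 1 2 by metis
  qed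
  ultimately have "strong_set E' ?S" unfolding strong_set_def by metis
  moreover have "card ?S = card S" by (rule card_image[OF inj_on_image[OF inj]])
  ultimately show ?thesis unfolding has_strong_def by blast
qed

section \<open>Matchings and the number of neighbourhood classes\<close>

definition matching :: "'a set set \<Rightarrow> 'a set set \<Rightarrow> bool" where
  "matching E M \<longleftrightarrow> M \<subseteq> E \<and> (\<forall>e\<in>M. \<forall>f\<in>M. e \<noteq> f \<longrightarrow> e \<inter> f = {})"

lemma matchingD: "matching E M \<Longrightarrow> e \<in> M \<Longrightarrow> f \<in> M \<Longrightarrow> x \<in> e \<Longrightarrow> x \<in> f \<Longrightarrow> e = f"
  unfolding matching_def by blast

text \<open>Two edges of a matching that share \<open>v\<close> coincide, hence \<open>u = w\<close>
  and the closure condition is void.\<close>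

lemma matching_strong_set:
  assumes "matching E M"
  shows "strong_set E M"
  unfolding strong_set_def
proof (intro conjI allI impI)
  show "M \<subseteq> E" using assms unfolding matching_def by blast
  fix u v w assume *: "u \<noteq> w" "{u, v} \<in> M" "{v, w} \<in> M"
  then have "{u, v} = {v, w}" by (intro matchingD[OF assms, where x = v]) auto
  then show "{u, w} \<in> E" using \<open>u \<noteq> w\<close> by (auto simp: doubleton_eq_iff)
qed

text \<open>On \<open>A\<close> the map \<open>f\<close> factors through \<open>h\<close>; the
  factor chooses a preimage under \<open>h\<close>.\<close>

lemma card_image_le_card_image:
  assumes "finite A" "\<And>x y. x \<in> A \<Longrightarrow> y \<in> A \<Longrightarrow> h x = h y \<Longrightarrow> f x = f y"
  shows "card (f ` A) \<le> card (h ` A)"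
proof -
  have "f ` A \<subseteq> (\<lambda>z. f (inv_into A h z)) ` (h ` A)"
  proof
    fix z assume "z \<in> f ` A"
    then obtain x where x: "x \<in> A" "z = f x" by blast
    have "f (inv_into A h (h x)) = f x"
      using x by (intro assms(2)) (auto simp: inv_into_into f_inv_into_f)
    then show "z \<in> (\<lambda>z. f (inv_into A h z)) ` (h ` A)" using x by (metis imageI)
  qed
  then show ?thesis using assms(1) by (meson card_image_le card_mono finite_imageI le_trans)
qed

lemma card_nbr_classes_le:
  fixes E :: "'a set set"
  assumes fin: "finite E" and two: "\<And>e. e \<in> E \<Longrightarrow> card e = 2"
    and no: "\<not> has_strong E l"
  shows "card (nbr E ` \<Union>E) \<le> 2 ^ Suc l"
proof -
  have ex: "\<exists>M. matching E M" by (rule exI[of _ "{}"]) (simp add: matching_def)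
  have "\<forall>M. matching E M \<longrightarrow> card M < Suc (card E)"
    using fin by (simp add: matching_def card_mono less_Suc_eq_le)
  from ex_has_greatest_nat[OF ex[THEN someI_ex] this]
  obtain M where M: "matching E M" and max: "\<And>M'. matching E M' \<Longrightarrow> card M' \<le> card M"
    by blast
  have ME: "M \<subseteq> E" and finM: "finite M"
    using M fin finite_subset unfolding matching_def by blast+
  have p: "card M < l"
    using has_strong_le[OF matching_strong_set[OF M], of l] no by linarith
  let ?C = "\<Union>M" let ?I = "\<Union>E - \<Union>M"
  have fine: "finite e" if "e \<in> E" for e using two[OF that] by (metis card.infinite zero_neq_numeral)
  have finR: "finite (\<Union>E)" using fin fine by blast
  have "card ?C \<le> (\<Sum>e\<in>M. card e)" by (rule card_Union_le_sum_card)
  also have "\<dots> = 2 * card M" using ME two by (simp add: subset_iff)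
  finally have cardC: "card ?C \<le> 2 * card M" .
  \<comment> \<open>A maximum matching cannot be extended, so all neighbours of an unmatched vertex
    are matched.\<close>
  have out: "x \<in> ?C" if "w \<notin> ?C" "{w, x} \<in> E" for w x
  proof (rule ccontr)
    assume x: "x \<notin> ?C"
    have "matching E (insert {w, x} M)"
      using M that x unfolding matching_def by auto
    moreover have "{w, x} \<notin> M" using that by blast
    ultimately show False using max finM by fastforce
  qed
  \<comment> \<open>Otherwise the edge \<open>{a, b}\<close> could be exchanged for the two outer
    edges of the path \<open>w, a, b, w'\<close>.\<close>
  have aug: "w = w'" if ab: "{a, b} \<in> M" "a \<noteq> b" and w: "w \<notin> ?C" "w' \<notin> ?C"
    and e: "{w, a} \<in> E" "{w', b} \<in> E" for a b w w'
  proof (rule ccontr)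
    assume "w \<noteq> w'"
    let ?M = "M - {{a, b}}"
    have dis: "f \<inter> {a, b} = {}" if "f \<in> ?M" for f
      using matchingD[OF M _ ab(1), of f] that by auto
    have wf: "w \<notin> f" "w' \<notin> f" if "f \<in> M" for f using w that by blast+
    have abw: "a \<noteq> w" "a \<noteq> w'" "b \<noteq> w" "b \<noteq> w'" using w ab by blast+
    have "matching E (insert {w, a} (insert {w', b} ?M))"
      using M e dis wf abw \<open>w \<noteq> w'\<close> \<open>a \<noteq> b\<close> unfolding matching_def by auto
    moreover have "card (insert {w, a} (insert {w', b} ?M)) = Suc (card M)"
    proof -
      have "{w', b} \<notin> ?M" "{w, a} \<notin> insert {w', b} ?M"
        using w abw \<open>w \<noteq> w'\<close> \<open>a \<noteq> b\<close> by (auto simp: doubleton_eq_iff)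
      then have "card (insert {w, a} (insert {w', b} ?M)) = Suc (Suc (card ?M))"
        using finM card_insert_disjoint[of "insert {w', b} ?M" "{w, a}"]
          card_insert_disjoint[of ?M "{w', b}"] by simp
      then show ?thesis using card_Suc_Diff1[OF finM ab(1)] by simp
    qed
    ultimately show False using max by fastforce
  qed
  \<comment> \<open>The trace on \<open>M\<close> records which matching edges are met, not at which
    end. This is enough: if \<open>w\<close> and \<open>w'\<close> met an edge at different ends,
    \<open>aug\<close> would make them equal.\<close>
  have half: "nbr E w \<subseteq> nbr E w'"
    if w: "w \<in> ?I" "w' \<in> ?I" and eq: "{e \<in> M. e \<inter> nbr E w \<noteq> {}} = {e \<in> M. e \<inter> nbr E w' \<noteq> {}}" for w w'
  proof
    fix x assume x: "x \<in> nbr E w"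
    then obtain e where e: "e \<in> M" "x \<in> e" using out[of w x] w by (auto simp: nbr_def)
    then have "e \<in> {e \<in> M. e \<inter> nbr E w \<noteq> {}}" using x by blast
    then obtain y where y: "y \<in> e" "y \<in> nbr E w'" unfolding eq by blast
    show "x \<in> nbr E w'"
    proof (cases "x = y")
      case False
      then have "e = {x, y}"
        using e y two[of e] ME by (auto simp: card_2_iff)
      then have "w = w'"
        using aug[of x y w w'] w x y e False by (auto simp: nbr_def)
      then show ?thesis using x by simp
    qed (use y in simp)
  qed
  have "card (nbr E ` ?I) \<le> card ((\<lambda>w. {e \<in> M. e \<inter> nbr E w \<noteq> {}}) ` ?I)"
  proof (rule card_image_le_card_image)
    show "finite ?I" using finR by simp
    show "nbr E x = nbr E y" if "x \<in> ?I" "y \<in> ?I"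
      "{e \<in> M. e \<inter> nbr E x \<noteq> {}} = {e \<in> M. e \<inter> nbr E y \<noteq> {}}" for x y
      using half[OF that] half[OF that(2,1) that(3)[symmetric]] by blast
  qed
  also have "\<dots> \<le> card (Pow M)" by (rule card_mono) (use finM in auto)
  also have "\<dots> = 2 ^ card M" using finM by (rule card_Pow)
  finally have I: "card (nbr E ` ?I) \<le> 2 ^ card M" .
  have "finite ?C" using finR ME by (meson Union_mono finite_subset)
  then have C: "card (nbr E ` ?C) \<le> 2 * card M" using card_image_le cardC le_trans by blast
  have "nbr E ` \<Union>E = nbr E ` ?C \<union> nbr E ` ?I" using ME by blast
  then have "card (nbr E ` \<Union>E) \<le> 2 * card M + 2 ^ card M"
    using card_Un_le[of "nbr E ` ?C" "nbr E ` ?I"] I C by simp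
  \<comment> \<open>By \<open>card M < 2 ^ card M\<close> the sum is below
    \<open>3 * 2 ^ card M\<close>; \<open>card M < l\<close> then bounds the exponent
    \<open>card M + 2\<close> by \<open>l + 1\<close>.\<close>
  also have "\<dots> \<le> 2 ^ Suc (Suc (card M))"
    using less_exp[of "card M"] by (simp, linarith)
  also have "\<dots> \<le> 2 ^ Suc l" using p by (intro power_increasing) auto
  finally show ?thesis .
qed

section \<open>Keeping at most \<open>l\<close> vertices of every class of false twins\<close>

locale twin_reduction =
  fixes E :: "'a set set" and K :: "'a set" and l :: nat and cl :: "'a \<Rightarrow> 'b"
    and f :: "'a \<Rightarrow> 'c"
  assumes fin: "finite E" and two: "e \<in> E \<Longrightarrow> card e = 2"
    and cl: "cl w = cl w' \<longleftrightarrow> nbr E w = nbr E w'"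
    and K: "K \<subseteq> \<Union>E"
    and cardK: "card {w \<in> K. cl w = x} = min l (card {w \<in> \<Union>E. cl w = x})"
    and injf: "inj_on f K"
begin

definition kern :: "'c set set" where "kern = (`) f ` {e \<in> E. e \<subseteq> K}"

lemma finite_Union: "finite (\<Union>E)"
proof -
  have "finite e" if "e \<in> E" for e using two[OF that] by (simp add: card_ge_0_finite)
  then show ?thesis using fin by blast
qed

lemma finite_class: "finite {w \<in> \<Union>E. cl w = x}"
  using finite_Union by (rule rev_finite_subset) auto

lemma adj_irrefl: "{u, v} \<in> E \<Longrightarrow> u \<noteq> v"
  using two by fastforce

text \<open>Endpoints are exchanged one at a time, each exchange being an equality of
  neighbourhoods. Together with \<open>adj_irrefl\<close> this makes every class
  independent.\<close>

lemma adj_cl: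
  assumes "cl u = cl u'" "cl v = cl v'"
  shows "{u, v} \<in> E \<longleftrightarrow> {u', v'} \<in> E"
proof -
  have "{u, v} \<in> E \<longleftrightarrow> {u', v} \<in> E" using assms(1)[unfolded cl] by (auto simp: nbr_def set_eq_iff)
  also have "\<dots> \<longleftrightarrow> {u', v'} \<in> E"
    using assms(2)[unfolded cl] by (auto simp: nbr_def set_eq_iff insert_commute)
  finally show ?thesis .
qed

lemma adj_kern:
  assumes "u \<in> K" "v \<in> K"
  shows "{u, v} \<in> E \<longleftrightarrow> {f u, f v} \<in> kern"
proof
  assume "{u, v} \<in> E"
  then show "{f u, f v} \<in> kern" unfolding kern_def using assms by (intro image_eqI[of _ _ "{u, v}"]) auto
next
  assume "{f u, f v} \<in> kern"
  then obtain e where e: "e \<in> E" "e \<subseteq> K" "f ` e = f ` {u, v}" unfolding kern_def by auto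
  then have "e = {u, v}" using inj_on_image_eq_iff[OF injf, of e "{u, v}"] assms by simp
  then show "{u, v} \<in> E" using e by simp
qed

lemma card_kern: "card kern = card {e \<in> E. e \<subseteq> K}"
  unfolding kern_def
  by (intro card_image inj_on_image inj_on_subset[OF injf]) auto

text \<open>A strong set of the kernel is renamed back by the inverse of \<open>f\<close>.
  Conversely, \<open>l\<close> strong edges use at most \<open>l\<close> vertices of a class, and at
  least as many of that class are kept, so their endpoints can be moved injectively to kept
  twins.\<close>

lemma has_strong_kern: "has_strong kern l \<longleftrightarrow> has_strong E l"
proof
  assume "has_strong kern l"
  then obtain S where S: "strong_set kern S" "card S = l" unfolding has_strong_def by blast
  have sub: "S \<subseteq> kern" using S(1) unfolding strong_set_def by blast
  let ?g = "inv_into K f"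
  have US: "\<Union>S \<subseteq> f ` K" using sub unfolding kern_def by fastforce
  have "has_strong E (card S)"
  proof (rule has_strong_transfer[OF S(1), where \<phi> = ?g])
    show "card e = 2" if e: "e \<in> S" for e
    proof -
      obtain e0 where e0: "e0 \<in> E" "e0 \<subseteq> K" "e = f ` e0"
        using e sub unfolding kern_def by blast
      then show ?thesis using two card_image[OF inj_on_subset[OF injf]] by metis
    qed
    show "inj_on ?g (\<Union>S)" using US by (rule inj_on_inv_into)
    show "{u, v} \<in> kern \<longleftrightarrow> {?g u, ?g v} \<in> E" if uv: "u \<in> \<Union>S" "v \<in> \<Union>S" "u \<noteq> v" for u v
    proof -
      have "?g u \<in> K" "?g v \<in> K" "f (?g u) = u" "f (?g v) = v"
        using uv US by (auto intro: inv_into_into f_inv_into_f)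
      then show ?thesis using adj_kern[of "?g u" "?g v"] by simp
    qed
  qed
  then show "has_strong E l" using S(2) by simp
next
  assume "has_strong E l"
  then obtain S where S: "strong_set E S" "card S = l" unfolding has_strong_def by blast
  have sub: "S \<subseteq> E" using S(1) unfolding strong_set_def by blast
  have finS: "finite S" using sub fin finite_subset by blast
  have ex: "\<exists>h. h ` {w \<in> \<Union>S. cl w = x} \<subseteq> {w \<in> K. cl w = x} \<and> inj_on h {w \<in> \<Union>S. cl w = x}" for x
  proof -
    let ?T = "{w \<in> \<Union>S. cl w = x}"
    have "\<forall>w\<in>?T. \<exists>e. e \<in> S \<and> w \<in> e" by blast
    then obtain ed where ed: "\<And>w. w \<in> ?T \<Longrightarrow> ed w \<in> S \<and> w \<in> ed w" by metis
    \<comment> \<open>An edge holding two vertices of the class would join false twins and yield a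
      loop. So each edge of \<open>S\<close> contributes at most one vertex to the class.\<close>
    have "inj_on ed ?T"
    proof (rule inj_onI, rule ccontr)
      fix w w' assume w: "w \<in> ?T" "w' \<in> ?T" "ed w = ed w'" "w \<noteq> w'"
      then have "{w, w'} \<subseteq> ed w" "ed w \<in> E" using ed sub by auto
      moreover have "card (ed w) = 2" using two calculation(2) by blast
      ultimately have "ed w = {w, w'}" using w(4) by (auto simp: card_2_iff)
      then have "{w, w'} \<in> E" using \<open>ed w \<in> E\<close> by simp
      then have "{w, w} \<in> E" using adj_cl[of w w w' w] w(1,2) by simp
      then show False using adj_irrefl by blast
    qed
    then have "card ?T \<le> l"
      using card_inj_on_le[of ed ?T S] ed finS S(2) by blast
    moreover have "card ?T \<le> card {w \<in> \<Union>E. cl w = x}"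
      using sub by (intro card_mono finite_class) auto
    ultimately have "card ?T \<le> card {w \<in> K. cl w = x}" unfolding cardK by simp
    moreover have "finite ?T" "finite {w \<in> K. cl w = x}"
      by (rule finite_subset[OF _ finite_Union], use sub K in auto)+
    ultimately show ?thesis using card_le_inj by blast
  qed
  define H where "H x = (SOME h. h ` {w \<in> \<Union>S. cl w = x} \<subseteq> {w \<in> K. cl w = x} \<and>
    inj_on h {w \<in> \<Union>S. cl w = x})" for x
  have H: "H x ` {w \<in> \<Union>S. cl w = x} \<subseteq> {w \<in> K. cl w = x}"
    "inj_on (H x) {w \<in> \<Union>S. cl w = x}" for x
    using someI_ex[OF ex[of x]] unfolding H_def by simp_all
  \<comment> \<open>The maps of the single classes are glued together. Each stays inside its class,
    so images from different classes cannot collide.\<close>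
  let ?h = "\<lambda>w. H (cl w) w"
  have h: "?h w \<in> K" "cl (?h w) = cl w" if "w \<in> \<Union>S" for w
    using H(1)[of "cl w"] that by auto
  have injh: "inj_on ?h (\<Union>S)"
  proof (rule inj_onI)
    fix w w' assume w: "w \<in> \<Union>S" "w' \<in> \<Union>S" and eq: "?h w = ?h w'"
    have c: "cl w = cl w'" using h(2)[OF w(1)] h(2)[OF w(2)] unfolding eq by (rule trans[OF sym])
    have "H (cl w) w = H (cl w) w'" using eq unfolding c .
    moreover have "w \<in> {v \<in> \<Union>S. cl v = cl w}" "w' \<in> {v \<in> \<Union>S. cl v = cl w}"
      using w c[symmetric] by blast+
    ultimately show "w = w'" by (rule inj_onD[OF H(2)])
  qed
  have "has_strong kern (card S)"
  proof (rule has_strong_transfer[OF S(1), where \<phi> = "f \<circ> ?h"])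
    show "card e = 2" if "e \<in> S" for e using that sub two by blast
    show "inj_on (f \<circ> ?h) (\<Union>S)"
      using injh h(1) by (intro comp_inj_on inj_on_subset[OF injf]) auto
    show "{u, v} \<in> E \<longleftrightarrow> {(f \<circ> ?h) u, (f \<circ> ?h) v} \<in> kern"
      if "u \<in> \<Union>S" "v \<in> \<Union>S" "u \<noteq> v" for u v
      using adj_cl[of u "?h u" v "?h v"] adj_kern[of "?h u" "?h v"] h that by simp
  qed
  then show "has_strong kern l" using S(2) by simp
qed

text \<open>This keeps the output budget \<open>card kern - l\<close> from being truncated. If no
  class loses a vertex, all edges survive. Otherwise some class has exactly \<open>l\<close> kept
  vertices, and all of them are joined to one kept vertex of a neighbouring class.\<close>

lemma card_kern_ge:
  assumes "l \<noteq> 0" "l \<le> card E"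
  shows "l \<le> card kern"
proof (cases "\<exists>x. l < card {w \<in> \<Union>E. cl w = x}")
  case False
  then have "card {w \<in> K. cl w = x} = card {w \<in> \<Union>E. cl w = x}" for x
    unfolding cardK by (simp add: not_less)
  moreover note finite_class
  moreover have "{w \<in> K. cl w = x} \<subseteq> {w \<in> \<Union>E. cl w = x}" for x using K by auto
  ultimately have eq: "{w \<in> K. cl w = x} = {w \<in> \<Union>E. cl w = x}" for x
    using card_subset_eq by metis
  have "\<Union>E \<subseteq> K"
  proof
    fix w assume "w \<in> \<Union>E"
    then have "w \<in> {w' \<in> \<Union>E. cl w' = cl w}" by simp
    then show "w \<in> K" unfolding eq[symmetric] by simp
  qed
  then have "{e \<in> E. e \<subseteq> K} = E" by blast
  then show ?thesis using assms by (simp add: card_kern)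
next
  case True
  then obtain x where x: "l < card {w \<in> \<Union>E. cl w = x}" by blast
  let ?A = "{w \<in> K. cl w = x}"
  have A: "card ?A = l" using x unfolding cardK by simp
  then obtain w0 where w0: "w0 \<in> ?A" using assms(1) by (metis card.empty equals0I)
  then obtain e where "e \<in> E" "w0 \<in> e" using K by blast
  then obtain y where y: "{w0, y} \<in> E" using two[of e] by (auto simp: card_2_iff insert_commute)
  then have "y \<in> {w \<in> \<Union>E. cl w = cl y}" by blast
  moreover note finite_class[of "cl y"]
  ultimately have "card {w \<in> \<Union>E. cl w = cl y} \<noteq> 0" by auto
  then have "card {w \<in> K. cl w = cl y} \<noteq> 0" unfolding cardK using assms(1) by simp
  \<comment> \<open>The neighbour \<open>y\<close> itself may have been dropped, but
    \<open>l \<noteq> 0\<close> guarantees that some twin of it is kept.\<close>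
  then obtain z where z: "z \<in> K" "cl z = cl y" by (metis (mono_tags, lifting) card.empty empty_Collect_eq)
  have e: "{w, z} \<in> E" if "w \<in> ?A" for w
    using adj_cl[of w w0 z y] that w0 z y by simp
  have "inj_on (\<lambda>w. {w, z}) ?A"
    by (rule inj_onI) (auto simp: doubleton_eq_iff)
  moreover have "(\<lambda>w. {w, z}) ` ?A \<subseteq> {e \<in> E. e \<subseteq> K}" using e z by auto
  moreover have "finite {e \<in> E. e \<subseteq> K}" using fin by simp
  ultimately have "card ?A \<le> card {e \<in> E. e \<subseteq> K}" using card_inj_on_le by blast
  then show ?thesis using A by (simp add: card_kern)
qed

lemma card_kept_le: "card K \<le> card (cl ` \<Union>E) * l"
proof -
  have "K \<subseteq> (\<Union>x\<in>cl ` \<Union>E. {w \<in> K. cl w = x})"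
  proof
    fix w assume "w \<in> K"
    then have "cl w \<in> cl ` \<Union>E" "w \<in> {w' \<in> K. cl w' = cl w}" using K by auto
    then show "w \<in> (\<Union>x\<in>cl ` \<Union>E. {w \<in> K. cl w = x})" by (rule UN_I)
  qed
  moreover have "finite (\<Union>x\<in>cl ` \<Union>E. {w \<in> K. cl w = x})"
    by (rule finite_subset[OF _ finite_subset[OF K finite_Union]]) auto
  ultimately have "card K \<le> card (\<Union>x\<in>cl ` \<Union>E. {w \<in> K. cl w = x})" by (rule card_mono[rotated])
  also have "\<dots> \<le> (\<Sum>x\<in>cl ` \<Union>E. card {w \<in> K. cl w = x})"
    using finite_Union by (intro card_UN_le) auto
  also have "\<dots> \<le> (\<Sum>x\<in>cl ` \<Union>E. l)" by (intro sum_mono) (simp add: cardK)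
  finally show ?thesis by simp
qed

end

section \<open>Weakest preconditions with a cost budget\<close>

text \<open>Here \<open>r\<close> is the budget before the run, and the second argument of
  \<open>Q\<close> is the budget left over. Passing the remainder on lets invariants hold credit for
  later steps, as amortized bounds need.\<close>

definition wp :: "com \<Rightarrow> (mem \<Rightarrow> nat \<Rightarrow> bool) \<Rightarrow> mem \<Rightarrow> nat \<Rightarrow> bool" where
  "wp c Q s r \<longleftrightarrow> (\<exists>t s' r'. exec c s t s' \<and> t + r' \<le> r \<and> Q s' r')"

lemma wp_mono:
  assumes "wp c P s r" "\<And>s r. P s r \<Longrightarrow> Q s r" "r \<le> r'"
  shows "wp c Q s r'"
  using assms unfolding wp_def by (meson le_trans)

text \<open>Frame rule for the budget: credit that \<open>c\<close> does not touch is still there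
  afterwards.\<close>

lemma wp_credit:
  assumes "wp c P s r" "\<And>s r. P s r \<Longrightarrow> Q s (r + b)"
  shows "wp c Q s (r + b)"
proof -
  obtain t s' r' where "exec c s t s'" "t + r' \<le> r" "P s' r'" using assms(1) unfolding wp_def by blast
  then have "exec c s t s' \<and> t + (r' + b) \<le> r + b \<and> Q s' (r' + b)" using assms(2) by simp
  then show ?thesis unfolding wp_def by blast
qed

lemma wp_Seq:
  assumes "wp c (wp d Q) s r"
  shows "wp (Seq c d) Q s r"
proof -
  obtain t s' r' where 1: "exec c s t s'" "t + r' \<le> r" "wp d Q s' r'"
    using assms unfolding wp_def by blast
  obtain t' s'' r'' where 2: "exec d s' t' s''" "t' + r'' \<le> r'" "Q s'' r''"
    using 1(3) unfolding wp_def by blast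
  have "exec (Seq c d) s (t + t') s''" using 1 2 by (intro exec.Seq)
  moreover have "t + t' + r'' \<le> r" using 1 2 by simp
  ultimately show ?thesis unfolding wp_def using 2(3) by blast
qed

lemma wp_If:
  assumes "val s e \<noteq> 0 \<Longrightarrow> wp c Q s r" "val s e = 0 \<Longrightarrow> wp d Q s r"
    and le: "cost e + 1 + r \<le> r'"
  shows "wp (If e c d) Q s r'"
proof (cases "val s e = 0")
  case True
  obtain t s' q where *: "exec d s t s'" "t + q \<le> r" "Q s' q"
    using assms(2)[OF True] unfolding wp_def by blast
  have "exec (If e c d) s (cost e + 1 + t) s'" using True *(1) by (rule exec.IfFalse)
  moreover have "cost e + 1 + t + q \<le> r'" using *(2) le by linarith
  ultimately show ?thesis unfolding wp_def using *(3) by blast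
next
  case False
  obtain t s' q where *: "exec c s t s'" "t + q \<le> r" "Q s' q"
    using assms(1)[OF False] unfolding wp_def by blast
  have "exec (If e c d) s (cost e + 1 + t) s'" using False *(1) by (rule exec.IfTrue)
  moreover have "cost e + 1 + t + q \<le> r'" using *(2) le by linarith
  ultimately show ?thesis unfolding wp_def using *(3) by blast
qed

text \<open>The budget strictly decreases in every iteration, which also yields termination.\<close>

lemma wp_While:
  assumes step: "\<And>s r. I s r \<Longrightarrow> val s e \<noteq> 0 \<Longrightarrow> \<exists>r'. cost e + 1 + r' \<le> r \<and> wp c I s r'"
    and final: "\<And>s r. I s r \<Longrightarrow> val s e = 0 \<Longrightarrow> \<exists>r'. cost e + 1 + r' \<le> r \<and> Q s r'"
    and I: "I s r"
  shows "wp (While e c) Q s r"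
  using I
proof (induction r arbitrary: s rule: less_induct)
  case (less r)
  show ?case
  proof (cases "val s e = 0")
    case True
    with final[OF less.prems] show ?thesis
      unfolding wp_def using exec.WhileFalse by blast
  next
    case False
    from step[OF less.prems False] obtain r' where
      r': "cost e + 1 + r' \<le> r" and "wp c I s r'" by blast
    then obtain t s1 r1 where 1: "exec c s t s1" "t + r1 \<le> r'" "I s1 r1"
      unfolding wp_def by blast
    have "r1 < r" using r' 1(2) by linarith
    from less.IH[OF this 1(3)] obtain t2 s2 r2
      where 2: "exec (While e c) s1 t2 s2" "t2 + r2 \<le> r1" "Q s2 r2"
      unfolding wp_def by blast
    have "exec (While e c) s (cost e + 1 + t + t2) s2"
      using False 1(1) 2(1) by (rule exec.WhileTrue)
    moreover have "cost e + 1 + t + t2 + r2 \<le> r" using r' 1(2) 2(2) by linarith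
    ultimately show ?thesis unfolding wp_def using 2(3) by blast
  qed
qed

section \<open>Direct evaluation of loop-free programs\<close>

primrec loop_free :: "com \<Rightarrow> bool" where
  "loop_free Skip \<longleftrightarrow> True"
| "loop_free (Store a i e) \<longleftrightarrow> True"
| "loop_free (Seq c d) \<longleftrightarrow> loop_free c \<and> loop_free d"
| "loop_free (If e c d) \<longleftrightarrow> loop_free c \<and> loop_free d"
| "loop_free (While e c) \<longleftrightarrow> False"

text \<open>Loop-free code is evaluated by the simplifier instead of rule by rule. The values of
  \<open>effect\<close> and \<open>max_cost\<close> at \<open>While\<close> are dummies that
  \<open>loop_free\<close> excludes.\<close>

primrec effect :: "com \<Rightarrow> mem \<Rightarrow> mem" where
  "effect Skip s = s"
| "effect (Store a i e) s = s(a := (s a)(val s i := val s e))"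
| "effect (Seq c d) s = effect d (effect c s)"
| "effect (If e c d) s = (if val s e \<noteq> 0 then effect c s else effect d s)"
| "effect (While e c) s = s"

primrec max_cost :: "com \<Rightarrow> nat" where
  "max_cost Skip = 1"
| "max_cost (Store a i e) = cost i + cost e + 1"
| "max_cost (Seq c d) = max_cost c + max_cost d"
| "max_cost (If e c d) = cost e + 1 + max (max_cost c) (max_cost d)"
| "max_cost (While e c) = 0"

lemma loop_free_exec: "loop_free c \<Longrightarrow> \<exists>t \<le> max_cost c. exec c s t (effect c s)"
proof (induction c arbitrary: s)
  case Skip
  show ?case using exec.Skip[of s] by auto
next
  case (Store a i e)
  show ?case using exec.Store[of a i e s] by (intro exI[of _ "cost i + cost e + 1"]) (simp del: fun_upd_apply)
next
  case (Seq c d)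
  then obtain t where t: "t \<le> max_cost c" "exec c s t (effect c s)" by fastforce
  from Seq obtain t' where t': "t' \<le> max_cost d" "exec d (effect c s) t' (effect d (effect c s))"
    by fastforce
  have "exec (Seq c d) s (t + t') (effect (Seq c d) s)"
    using t t' by (auto intro: exec.Seq)
  moreover have "t + t' \<le> max_cost (Seq c d)" using t t' by simp
  ultimately show ?case by blast
next
  case (If e c d)
  show ?case
  proof (cases "val s e = 0")
    case True
    from If obtain t where t: "t \<le> max_cost d" "exec d s t (effect d s)" by fastforce
    have "exec (If e c d) s (cost e + 1 + t) (effect (If e c d) s)"
      using exec.IfFalse[OF True t(2)] True by simp
    moreover have "cost e + 1 + t \<le> max_cost (If e c d)" using t by simp
    ultimately show ?thesis by blast
  next
    case False
    from If obtain t where t: "t \<le> max_cost c" "exec c s t (effect c s)" by fastforce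
    have "exec (If e c d) s (cost e + 1 + t) (effect (If e c d) s)"
      using exec.IfTrue[OF False t(2)] False by simp
    moreover have "cost e + 1 + t \<le> max_cost (If e c d)" using t by simp
    ultimately show ?thesis by blast
  qed
qed simp

lemma wp_loop_free:
  assumes "loop_free c" "Q (effect c s) r" "max_cost c + r \<le> r'"
  shows "wp c Q s r'"
proof -
  obtain t where "t \<le> max_cost c" "exec c s t (effect c s)" using loop_free_exec[OF assms(1)] by blast
  moreover from this have "t + r \<le> r'" using assms(3) by simp
  ultimately show ?thesis unfolding wp_def using assms(2) by blast
qed

abbreviation var :: "string \<Rightarrow> exp" where "var a \<equiv> Cell a (Const 0)"
abbreviation assign :: "string \<Rightarrow> exp \<Rightarrow> com" where "assign a e \<equiv> Store a (Const 0) e"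

definition for_edges :: "com \<Rightarrow> com" where
  "for_edges c = Seq (assign ''i'' (Const 0))
     (While (Monus (var ''m'') (var ''i'')) (Seq c (assign ''i'' (Inc (var ''i'')))))"

text \<open>\<open>J\<close> may carry credit besides the \<open>b\<close> units granted to each
  iteration. The 11 units are the test (6) and the increment (5), the 9 units the initial assignment
  (3) and the last test (6). Independence of the counter array lets \<open>J\<close> survive the
  increment.\<close>

lemma wp_for_edges:
  assumes frame: "\<And>j s f r. J j (s(''i'' := f)) r \<longleftrightarrow> J j s r"
    and body: "\<And>j s r. j < m \<Longrightarrow> J j s r \<Longrightarrow> s ''i'' 0 = j \<Longrightarrow> s ''m'' 0 = m \<Longrightarrow>
       wp c (\<lambda>s r. s ''i'' 0 = j \<and> s ''m'' 0 = m \<and> J (Suc j) s r) s (r + b)"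
    and init: "J 0 s r" "s ''m'' 0 = m"
    and budget: "r + m * (b + 11) + 9 \<le> r'"
  shows "wp (for_edges c) (J m) s r'"
  unfolding for_edges_def
proof (rule wp_Seq, rule wp_loop_free)
  let ?e = "Monus (var ''m'') (var ''i'')"
  let ?I = "\<lambda>s r. s ''m'' 0 = m \<and> s ''i'' 0 \<le> m \<and>
    (\<exists>q. q + (m - s ''i'' 0) * (b + 11) + 6 \<le> r \<and> J (s ''i'' 0) s q)"
  show "wp (While ?e (Seq c (assign ''i'' (Inc (var ''i''))))) (J m)
     (effect (assign ''i'' (Const 0)) s) (r + m * (b + 11) + 6)"
  proof (rule wp_While[where I = ?I])
    fix s r assume I: "?I s r" and "val s ?e \<noteq> 0"
    then have lt: "s ''i'' 0 < m" by simp
    from I obtain q where q: "q + (m - s ''i'' 0) * (b + 11) + 6 \<le> r" "J (s ''i'' 0) s q" by blast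
    let ?rest = "(m - Suc (s ''i'' 0)) * (b + 11) + 6"
    have "(m - s ''i'' 0) * (b + 11) = (m - Suc (s ''i'' 0)) * (b + 11) + (b + 11)"
      using lt by (metis Suc_diff_Suc add.commute mult_Suc)
    then have "cost ?e + 1 + (q + b + (5 + ?rest)) \<le> r" using q(1) by simp
    moreover have "wp (Seq c (assign ''i'' (Inc (var ''i'')))) ?I s (q + b + (5 + ?rest))"
    proof (rule wp_Seq, rule wp_credit[OF body[OF lt q(2)]])
      fix s' r' assume *: "s' ''i'' 0 = s ''i'' 0 \<and> s' ''m'' 0 = m \<and> J (Suc (s ''i'' 0)) s' r'"
      show "wp (assign ''i'' (Inc (var ''i''))) ?I s' (r' + (5 + ?rest))"
        by (rule wp_loop_free[where r = "r' + ?rest"]) (use * lt frame in auto)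
    qed (use I in simp_all)
    ultimately show "\<exists>r'. cost ?e + 1 + r' \<le> r \<and> wp (Seq c (assign ''i'' (Inc (var ''i'')))) ?I s r'"
      by blast
  next
    fix s r assume I: "?I s r" and "val s ?e = 0"
    then have "s ''i'' 0 = m" by simp
    with I obtain q where "q + 6 \<le> r" "J m s q" by auto
    then show "\<exists>r'. cost ?e + 1 + r' \<le> r \<and> J m s r'" by (intro exI[of _ q]) simp
  qed (use init frame in auto)
qed (use budget in simp_all)

section \<open>The kernelization program\<close>

text \<open>
  Adjacency lists: \<open>''h''\<close> maps a vertex to its first cell, \<open>''y''\<close> and \<open>''x''\<close> map a cell to the
  neighbour stored there and to the next cell, \<open>''d''\<close> is the last cell in use.
  Classes: \<open>''C''\<close> maps a vertex to its class, \<open>''f''\<close> is the last class in use, \<open>''z''\<close> maps a class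
  to the one most recently split off from it, \<open>''q''\<close> counts the nonempty ones.
  Reduction: \<open>''s''\<close> marks visited vertices, \<open>''a''\<close> counts the kept vertices of a class, \<open>''I''\<close> is
  one plus the new name of a vertex (0 if it is dropped), \<open>''N''\<close> and \<open>''M''\<close> count the kept vertices
  and edges. The parameter is \<open>''l''\<close>.
\<close>

definition link_edges :: com where
  "link_edges = for_edges
    (Seq (assign ''d'' (Inc (var ''d'')))
    (Seq (Store ''y'' (var ''d'') (Cell ''v'' (var ''i'')))
    (Seq (Store ''x'' (var ''d'') (Cell ''h'' (Cell ''u'' (var ''i''))))
    (Seq (Store ''h'' (Cell ''u'' (var ''i'')) (var ''d''))
    (Seq (assign ''d'' (Inc (var ''d'')))
    (Seq (Store ''y'' (var ''d'') (Cell ''u'' (var ''i'')))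
    (Seq (Store ''x'' (var ''d'') (Cell ''h'' (Cell ''v'' (var ''i''))))
         (Store ''h'' (Cell ''v'' (var ''i'')) (var ''d'')))))))))"

definition split_step :: com where
  "split_step =
    Seq (assign ''w'' (Cell ''y'' (var ''p'')))
    (Seq (assign ''b'' (Cell ''C'' (var ''w'')))
    (Seq (If (Monus (Cell ''z'' (var ''b'')) (var ''o'')) Skip
           (Seq (assign ''f'' (Inc (var ''f''))) (Store ''z'' (var ''b'') (var ''f''))))
    (Seq (Store ''C'' (var ''w'') (Cell ''z'' (var ''b'')))
         (assign ''p'' (Cell ''x'' (var ''p''))))))"

text \<open>Emptying the list of a vertex marks it as processed.\<close>

definition split_by :: "exp \<Rightarrow> com" where
  "split_by e =
    Seq (Seq (assign ''c'' e) (Seq (assign ''o'' (var ''f'')) (assign ''p'' (Cell ''h'' (var ''c'')))))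
    (Seq (While (var ''p'') split_step)
         (Store ''h'' (var ''c'') (Const 0)))"

definition refine :: com where
  "refine = for_edges (Seq (split_by (Cell ''u'' (var ''i''))) (split_by (Cell ''v'' (var ''i''))))"

text \<open>Since \<open>l\<close> is nonzero whenever this runs, \<open>a[b]\<close> is 0 exactly
  as long as no vertex of class \<open>b\<close> has been visited. So the same counter detects new
  classes and stops the keeping after \<open>l\<close> vertices.\<close>

definition keep :: "exp \<Rightarrow> com" where
  "keep e =
    Seq (assign ''w'' e)
    (Seq (assign ''b'' (Cell ''C'' (var ''w'')))
    (If (Cell ''s'' (var ''w'')) Skip
      (Seq (Store ''s'' (var ''w'') (Const 1))
      (Seq (If (Cell ''a'' (var ''b'')) Skip (assign ''q'' (Inc (var ''q''))))
           (If (Monus (var ''l'') (Cell ''a'' (var ''b'')))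
             (Seq (Store ''a'' (var ''b'') (Inc (Cell ''a'' (var ''b''))))
             (Seq (assign ''N'' (Inc (var ''N'')))
                  (Store ''I'' (var ''w'') (var ''N''))))
             Skip)))))"

definition keep_all :: com where
  "keep_all = for_edges (Seq (keep (Cell ''u'' (var ''i''))) (keep (Cell ''v'' (var ''i''))))"

text \<open>Computes \<open>''g'' = \<lfloor>log 2 ''q''\<rfloor>\<close> in linear time with the invariant
  \<open>''j'' + ''r'' = 2 ^ (''g'' + 1)\<close>, \<open>0 < ''r'' \<le> 2 ^ ''g''\<close>.\<close>

definition log_classes :: com where
  "log_classes =
    Seq (Seq (assign ''j'' (Const 1)) (assign ''r'' (Const 1)))
    (While (Monus (var ''q'') (var ''j''))
      (Seq (assign ''j'' (Inc (var ''j'')))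
      (Seq (assign ''r'' (Monus (var ''r'') (Const 1)))
           (If (var ''r'') Skip
             (Seq (assign ''r'' (var ''j'')) (assign ''g'' (Inc (var ''g''))))))))"

text \<open>For \<open>M = i\<close> the edge is overwritten while it is being read. Both tests
  precede the stores, the first store reads only \<open>u[i]\<close> and the second only
  \<open>v[i]\<close>, so no value is lost.\<close>

definition copy_edge :: com where
  "copy_edge =
    If (Cell ''I'' (Cell ''u'' (var ''i'')))
      (If (Cell ''I'' (Cell ''v'' (var ''i'')))
        (Seq (Store ''u'' (var ''M'') (Monus (Cell ''I'' (Cell ''u'' (var ''i''))) (Const 1)))
        (Seq (Store ''v'' (var ''M'') (Monus (Cell ''I'' (Cell ''v'' (var ''i''))) (Const 1)))
             (assign ''M'' (Inc (var ''M'')))))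
        Skip) Skip"

text \<open>Writing the output over the input is safe because \<open>''M'' \<le> ''i''\<close>.\<close>

definition output_kept :: com where
  "output_kept = Seq (for_edges copy_edge)
    (Seq (assign ''n'' (var ''N''))
    (Seq (assign ''m'' (var ''M''))
         (assign ''k'' (Monus (var ''M'') (var ''l'')))))"

definition output_yes :: com where
  "output_yes = Seq (assign ''n'' (Const 0)) (Seq (assign ''m'' (Const 0)) (assign ''k'' (Const 0)))"

text \<open>Parameter 0 means yes, by the empty set of strong edges. Past this test \<open>l\<close>
  is positive, which both \<open>keep\<close> and the lower bound on the number of kept edges
  require.\<close>

definition kernelize :: com where
  "kernelize =
    Seq (assign ''l'' (Monus (var ''m'') (var ''k'')))
    (If (var ''l'')
      (Seq link_edges (Seq refine (Seq keep_all (Seq log_classes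
        (If (Monus (var ''g'') (Inc (var ''l''))) output_yes output_kept)))))
      output_yes)"

section \<open>Adjacency lists\<close>

text \<open>Cell 0 is the null pointer; pointers decrease along a list, so that allocating new cells
  does not affect it.\<close>

primrec linked :: "(nat \<Rightarrow> nat) \<Rightarrow> (nat \<Rightarrow> nat) \<Rightarrow> nat \<Rightarrow> nat list \<Rightarrow> bool" where
  "linked y x p [] \<longleftrightarrow> p = 0"
| "linked y x p (w # ws) \<longleftrightarrow> p \<noteq> 0 \<and> y p = w \<and> x p < p \<and> linked y x (x p) ws"

text \<open>Pointers decrease, so a list starting at \<open>p\<close> never leaves the cells up to
  \<open>p\<close>.\<close>

lemma linked_cong:
  "(\<And>q. q \<le> p \<Longrightarrow> y q = y' q \<and> x q = x' q) \<Longrightarrow> linked y x p ws \<Longrightarrow> linked y' x' p ws"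
  by (induction ws arbitrary: p) auto

lemma linked_Nil_iff: "linked y x 0 ws \<longleftrightarrow> ws = []"
  by (cases ws) auto

lemma linked_alloc:
  assumes "linked y x p ws" "p < q"
  shows "linked (y(q := w)) (x(q := p)) q (w # ws)" "linked (y(q := w)) (x(q := p')) p ws"
proof -
  show "linked (y(q := w)) (x(q := p')) p ws" for p'
    by (rule linked_cong[OF _ assms(1)]) (use assms(2) in auto)
  then show "linked (y(q := w)) (x(q := p)) q (w # ws)" using assms(2) by simp
qed

definition agree :: "string set \<Rightarrow> mem \<Rightarrow> mem \<Rightarrow> bool" where
  "agree A s s' \<longleftrightarrow> (\<forall>a. a \<notin> A \<longrightarrow> s' a = s a)"

lemma agreeD: "agree A s s' \<Longrightarrow> a \<notin> A \<Longrightarrow> s' a = s a"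
  by (simp add: agree_def)

lemma agree_refl: "agree A s s"
  by (simp add: agree_def)

lemma agree_trans: "agree A s s' \<Longrightarrow> agree B s' s'' \<Longrightarrow> A \<union> B \<subseteq> C \<Longrightarrow> agree C s s''"
  unfolding agree_def by (metis UnCI subset_iff)

lemma agree_upd: "a \<in> A \<Longrightarrow> agree A s (s'(a := f)) \<longleftrightarrow> agree A s s'"
  by (auto simp: agree_def)

text \<open>The bound \<open>d\<close> on all heads leaves cell \<open>d + 1\<close> free for
  allocation. Distinctness makes the length of a list the size of \<open>W c\<close>, which the time
  bound needs, and lets refinement move each neighbour only once.\<close>

definition adj_lists :: "(nat \<Rightarrow> nat) \<Rightarrow> (nat \<Rightarrow> nat) \<Rightarrow> (nat \<Rightarrow> nat) \<Rightarrow> nat \<Rightarrow> (nat \<Rightarrow> nat set) \<Rightarrow> bool" where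
  "adj_lists y x h d W \<longleftrightarrow>
    (\<forall>c. h c \<le> d \<and> (\<exists>ws. linked y x (h c) ws \<and> distinct ws \<and> set ws = W c))"

lemma adj_lists_link:
  assumes "adj_lists y x h d W" "b \<notin> W a"
  shows "adj_lists (y(Suc d := b)) (x(Suc d := h a)) (h(a := Suc d)) (Suc d) (W(a := insert b (W a)))"
  unfolding adj_lists_def
proof (intro allI conjI)
  fix c
  obtain ws where ws: "linked y x (h c) ws" "distinct ws" "set ws = W c" and le: "h c \<le> d"
    using assms(1) unfolding adj_lists_def by blast
  show "(h(a := Suc d)) c \<le> Suc d" using le by simp
  show "\<exists>ws. linked (y(Suc d := b)) (x(Suc d := h a)) ((h(a := Suc d)) c) ws \<and> distinct ws \<and>
    set ws = (W(a := insert b (W a))) c"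
  proof (cases "c = a")
    case True
    then show ?thesis
      using linked_alloc(1)[OF ws(1), of "Suc d" b] ws le assms(2)
      by (intro exI[of _ "b # ws"]) simp
  next
    case False
    then show ?thesis
      using linked_alloc(2)[OF ws(1), of "Suc d" b "h a"] ws le by (intro exI[of _ ws]) simp
  qed
qed

section \<open>Edge arrays and a potential on arcs\<close>

locale edge_list =
  fixes uu vv :: "nat \<Rightarrow> nat" and m :: nat and E :: "nat set set"
  assumes edges: "bij_betw (\<lambda>i. {uu i, vv i}) {..<m} E"
    and two: "e \<in> E \<Longrightarrow> card e = 2"
begin

definition ends :: "nat \<Rightarrow> nat set" where "ends j = (\<Union>k<j. {uu k, vv k})"

lemma edge: "k < m \<Longrightarrow> {uu k, vv k} \<in> E"
  using edges bij_betwE by fastforce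

lemma uv_neq: "k < m \<Longrightarrow> uu k \<noteq> vv k"
  using two[OF edge] by fastforce

lemma E_eq: "E = (\<lambda>i. {uu i, vv i}) ` {..<m}"
  using edges bij_betw_imp_surj_on by metis

lemma edge_inj: "k < m \<Longrightarrow> k' < m \<Longrightarrow> {uu k, vv k} = {uu k', vv k'} \<longleftrightarrow> k = k'"
  using edges unfolding bij_betw_def inj_on_def by auto

lemma finite_E: "finite E"
  unfolding E_eq by simp

lemma card_E: "card E = m"
  using bij_betw_same_card[OF edges] by simp

lemma ends_Suc: "ends (Suc j) = insert (vv j) (insert (uu j) (ends j))"
  unfolding ends_def by (auto simp: lessThan_Suc)

lemma ends_m: "ends m = \<Union>E"
  unfolding ends_def E_eq by simp

lemma card_ends: "card (ends j) \<le> 2 * j" and finite_ends: "finite (ends j)"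
proof (induction j)
  case (Suc j)
  { case 1 then show ?case using Suc by (simp add: ends_Suc card_insert_if) }
  { case 2 then show ?case using Suc by (simp add: ends_Suc) }
qed (simp_all add: ends_def)

lemma nbr_sub: "nbr E c \<subseteq> \<Union>E"
  by (auto simp: nbr_def)

lemma finite_nbr: "finite (nbr E c)"
  using nbr_sub[of c] finite_ends[of m] ends_m finite_subset by metis

text \<open>Potential of the refinement: each arc leaving an unprocessed vertex pays for one list
  cell still to be traversed.\<close>

definition pot :: "nat set \<Rightarrow> nat" where
  "pot D = card {(c, x). {c, x} \<in> E \<and> c \<notin> D}"

lemma arcs_sub: "{(c, x). {c, x} \<in> E} \<subseteq> (\<lambda>k. (uu k, vv k)) ` {..<m} \<union> (\<lambda>k. (vv k, uu k)) ` {..<m}"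
  unfolding E_eq by (auto simp: doubleton_eq_iff)

lemma finite_arcs: "finite {(c, x). {c, x} \<in> E}"
  using arcs_sub by (rule finite_subset) simp

lemma pot_le: "pot {} \<le> 2 * m"
proof -
  have "pot {} \<le> card ((\<lambda>k. (uu k, vv k)) ` {..<m} \<union> (\<lambda>k. (vv k, uu k)) ` {..<m})"
    unfolding pot_def using arcs_sub by (intro card_mono) auto
  also have "\<dots> \<le> card ((\<lambda>k. (uu k, vv k)) ` {..<m}) + card ((\<lambda>k. (vv k, uu k)) ` {..<m})"
    by (rule card_Un_le)
  also have "\<dots> \<le> card {..<m} + card {..<m}" by (intro add_mono card_image_le) auto
  finally show ?thesis by simp
qed

text \<open>Processing \<open>c\<close> releases credit for exactly the cells of its current list,
  which is empty if \<open>c\<close> has been processed before.\<close>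

lemma pot_insert: "pot D = pot (insert c D) + card (if c \<in> D then {} else nbr E c)"
proof (cases "c \<in> D")
  case False
  have eq: "{(c', x). {c', x} \<in> E \<and> c' \<notin> D} =
      {(c', x). {c', x} \<in> E \<and> c' \<notin> insert c D} \<union> {c} \<times> nbr E c"
    using False by (auto simp: nbr_def)
  have "finite {(c', x). {c', x} \<in> E \<and> c' \<notin> insert c D}"
    by (rule finite_subset[OF _ finite_arcs]) auto
  then have "pot D = pot (insert c D) + card ({c} \<times> nbr E c)"
    unfolding pot_def eq using finite_nbr by (intro card_Un_disjoint) auto
  then show ?thesis using False by (simp add: card_cartesian_product_singleton)
qed (simp add: insert_absorb)

lemma wp_link_edges:
  assumes s: "s ''u'' = uu" "s ''v'' = vv" "s ''m'' 0 = m"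
    and zero: "s ''h'' = (\<lambda>_. 0)"
  shows "wp link_edges (\<lambda>s' r'. r' = r \<and> agree {''i'', ''d'', ''h'', ''y'', ''x''} s s' \<and>
    (\<exists>d. adj_lists (s' ''y'') (s' ''x'') (s' ''h'') d (nbr E))) s (r + m * 59 + 9)"
proof -
  let ?A = "{''i'', ''d'', ''h'', ''y'', ''x''}"
  let ?W = "\<lambda>j c. {w. \<exists>k<j. {uu k, vv k} = {c, w}}"
  let ?J = "\<lambda>j s' r'. r' = r \<and> agree ?A s s' \<and>
    adj_lists (s' ''y'') (s' ''x'') (s' ''h'') (s' ''d'' 0) (?W j)"
  have "wp link_edges (?J m) s (r + m * 59 + 9)"
    unfolding link_edges_def
  proof (rule wp_for_edges)
    show "?J j (s'(''i'' := f)) r' = ?J j s' r'" for j s' f r' by (simp add: agree_upd)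
    show "?J 0 s r" using zero by (simp add: adj_lists_def agree_refl linked_Nil_iff)
    fix j s' r' assume j: "j < m" and J: "?J j s' r'" and i: "s' ''i'' 0 = j" "s' ''m'' 0 = m"
    from J have agr: "agree ?A s s'" by blast
    have uv: "s' ''u'' = uu" "s' ''v'' = vv"
      using s agreeD[OF agr, of "''u''"] agreeD[OF agr, of "''v''"] by simp_all
    \<comment> \<open>No edge is listed twice, so neither new entry occurs in its list yet. For the
      second insertion, absence of loops ensures that the first one went to a different
      list.\<close>
    have new: "\<not> (\<exists>k<j. {uu k, vv k} = {uu j, vv j})" using edge_inj[OF _ j] j by auto
    then have "vv j \<notin> ?W j (uu j)" by simp
    from adj_lists_link[OF conjunct2[OF conjunct2[OF J]] this]
    have 1: "adj_lists ((s' ''y'')(Suc (s' ''d'' 0) := vv j)) ((s' ''x'')(Suc (s' ''d'' 0) := s' ''h'' (uu j)))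
      ((s' ''h'')(uu j := Suc (s' ''d'' 0))) (Suc (s' ''d'' 0)) ((?W j)(uu j := insert (vv j) (?W j (uu j))))" .
    have "uu j \<notin> ((?W j)(uu j := insert (vv j) (?W j (uu j)))) (vv j)"
      using new uv_neq[OF j] by (simp add: insert_commute)
    note 2 = adj_lists_link[OF 1 this]
    have W: "((?W j)(uu j := insert (vv j) (?W j (uu j)))) (vv j := insert (uu j)
      (((?W j)(uu j := insert (vv j) (?W j (uu j)))) (vv j))) = ?W (Suc j)"
      using uv_neq[OF j] by (auto simp: fun_eq_iff less_Suc_eq doubleton_eq_iff)
    show "wp (Seq (assign ''d'' (Inc (var ''d'')))
      (Seq (Store ''y'' (var ''d'') (Cell ''v'' (var ''i'')))
      (Seq (Store ''x'' (var ''d'') (Cell ''h'' (Cell ''u'' (var ''i''))))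
      (Seq (Store ''h'' (Cell ''u'' (var ''i'')) (var ''d''))
      (Seq (assign ''d'' (Inc (var ''d'')))
      (Seq (Store ''y'' (var ''d'') (Cell ''u'' (var ''i'')))
      (Seq (Store ''x'' (var ''d'') (Cell ''h'' (Cell ''v'' (var ''i''))))
           (Store ''h'' (Cell ''v'' (var ''i'')) (var ''d'')))))))))
      (\<lambda>s r. s ''i'' 0 = j \<and> s ''m'' 0 = m \<and> ?J (Suc j) s r) s' (r' + 48)"
      by (rule wp_loop_free[where r = r])
        (use J i uv 2[unfolded W] in \<open>simp_all add: agree_upd\<close>)
  qed (use s in simp_all)
  moreover have "?W m = nbr E" unfolding E_eq nbr_def by (auto simp: fun_eq_iff)
  ultimately show ?thesis by (elim wp_mono) auto
qed

end

section \<open>Partition refinement\<close>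

text \<open>A class \<open>b\<close> has already been split in the current round iff its entry in \<open>''z''\<close> exceeds
  the number \<open>''o''\<close> of the last class present at the beginning of the round.\<close>

definition splitting :: "nat \<Rightarrow> (nat \<Rightarrow> nat) \<Rightarrow> nat set \<Rightarrow> (nat \<Rightarrow> nat) \<Rightarrow> (nat \<Rightarrow> nat) \<Rightarrow> nat \<Rightarrow> bool" where
  "splitting o\<^sub>0 C\<^sub>0 P C z f \<longleftrightarrow>
    (\<forall>w. C w = (if w \<in> P then z (C\<^sub>0 w) else C\<^sub>0 w)) \<and> (\<forall>w\<in>P. o\<^sub>0 < z (C\<^sub>0 w)) \<and>
    (\<forall>b. z b \<le> f) \<and> o\<^sub>0 \<le> f \<and> (\<forall>b b'. o\<^sub>0 < z b \<longrightarrow> z b = z b' \<longrightarrow> b = b')"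

lemma splitting_old:
  assumes "splitting o\<^sub>0 C\<^sub>0 P C z f" "w \<notin> P" "o\<^sub>0 < z (C w)"
  shows "splitting o\<^sub>0 C\<^sub>0 (insert w P) (C(w := z (C w))) z f"
  using assms unfolding splitting_def by auto

text \<open>Redirecting \<open>z\<close> at \<open>C w\<close> disturbs no vertex moved before:
  those come from classes whose entry exceeds \<open>o\<^sub>0\<close>, unlike that of
  \<open>C w\<close>. Injectivity survives because \<open>Suc f\<close> is larger than every entry
  of \<open>z\<close>.\<close>

lemma splitting_new:
  assumes "splitting o\<^sub>0 C\<^sub>0 P C z f" "w \<notin> P" "z (C w) \<le> o\<^sub>0"
  shows "splitting o\<^sub>0 C\<^sub>0 (insert w P) (C(w := Suc f)) (z(C w := Suc f)) (Suc f)"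
proof -
  have Cw: "C w = C\<^sub>0 w" and le: "\<And>b. z b \<le> f" and P: "\<And>v. v \<in> P \<Longrightarrow> o\<^sub>0 < z (C\<^sub>0 v)"
    and o: "o\<^sub>0 \<le> f" and inj: "\<And>b b'. o\<^sub>0 < z b \<Longrightarrow> z b = z b' \<Longrightarrow> b = b'"
    and C: "\<And>v. C v = (if v \<in> P then z (C\<^sub>0 v) else C\<^sub>0 v)"
    using assms unfolding splitting_def by simp_all
  have ne: "C\<^sub>0 v \<noteq> C\<^sub>0 w" if "v \<in> P" for v using P[OF that] assms(3) Cw by force
  have lt: "z b \<noteq> Suc f" for b using le[of b] by simp
  show ?thesis
    unfolding splitting_def
  proof (intro conjI allI ballI impI)
    show "(C(w := Suc f)) v = (if v \<in> insert w P then (z(C w := Suc f)) (C\<^sub>0 v) else C\<^sub>0 v)" for v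
      using C[of v] ne[of v] Cw assms(2) by auto
    show "o\<^sub>0 < (z(C w := Suc f)) (C\<^sub>0 v)" if "v \<in> insert w P" for v
      using that P ne Cw o by auto
    show "(z(C w := Suc f)) b \<le> Suc f" for b using le[of b] by simp
    show "o\<^sub>0 \<le> Suc f" using o by simp
    show "b = b'" if "o\<^sub>0 < (z(C w := Suc f)) b" "(z(C w := Suc f)) b = (z(C w := Suc f)) b'" for b b'
      using that inj[of b b'] lt[of b] lt[of b'] by (simp split: if_splits)
  qed
qed

text \<open>A cell costs 38 for the body and 3 for the test. In the invariant \<open>vs\<close> is
  the rest of the list and \<open>P\<close> the set of moved vertices. The assumption on
  \<open>z\<close> says that no class has been split in this round.\<close>

lemma wp_split_loop:
  assumes ws: "linked (s ''y'') (s ''x'') (s ''p'' 0) ws" "distinct ws"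
    and init: "\<And>b. s ''z'' b \<le> s ''o'' 0" "s ''f'' 0 = s ''o'' 0"
  shows "wp (While (var ''p'') split_step) (\<lambda>s' r'. r' = r \<and>
      agree {''w'', ''b'', ''f'', ''z'', ''C'', ''p''} s s' \<and>
      splitting (s ''o'' 0) (s ''C'') (set ws) (s' ''C'') (s' ''z'') (s' ''f'' 0))
    s (r + length ws * 41 + 3)"
proof -
  let ?A = "{''w'', ''b'', ''f'', ''z'', ''C'', ''p''}"
  let ?I = "\<lambda>s' r'. agree ?A s s' \<and> (\<exists>vs P. linked (s ''y'') (s ''x'') (s' ''p'' 0) vs \<and> distinct vs \<and>
     set vs \<inter> P = {} \<and> set ws = set vs \<union> P \<and> r' = r + length vs * 41 + 3 \<and>
     splitting (s ''o'' 0) (s ''C'') P (s' ''C'') (s' ''z'') (s' ''f'' 0))"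
  show ?thesis
  proof (rule wp_While[where I = ?I])
    have "splitting (s ''o'' 0) (s ''C'') {} (s ''C'') (s ''z'') (s ''f'' 0)"
      using init unfolding splitting_def by (auto simp: not_less[symmetric])
    then show "?I s (r + length ws * 41 + 3)"
      using ws by (intro conjI agree_refl exI[of _ ws] exI[of _ "{}"]) simp_all
  next
    fix s' r' assume I: "?I s' r'" and "val s' (var ''p'') = 0"
    then obtain vs P where "linked (s ''y'') (s ''x'') 0 vs" "set ws = set vs \<union> P"
      "r' = r + length vs * 41 + 3" "splitting (s ''o'' 0) (s ''C'') P (s' ''C'') (s' ''z'') (s' ''f'' 0)"
      by auto
    moreover from this have "vs = []" by (simp add: linked_Nil_iff)
    ultimately show "\<exists>r''. cost (var ''p'') + 1 + r'' \<le> r' \<and> r'' = r \<and> agree ?A s s' \<and>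
      splitting (s ''o'' 0) (s ''C'') (set ws) (s' ''C'') (s' ''z'') (s' ''f'' 0)"
      using I by (intro exI[of _ r]) simp
  next
    fix s' r' assume I: "?I s' r'" and p: "val s' (var ''p'') \<noteq> 0"
    then obtain vs P where vs: "linked (s ''y'') (s ''x'') (s' ''p'' 0) vs" "distinct vs"
      "set vs \<inter> P = {}" "set ws = set vs \<union> P" "r' = r + length vs * 41 + 3"
      and sp: "splitting (s ''o'' 0) (s ''C'') P (s' ''C'') (s' ''z'') (s' ''f'' 0)"
      by auto
    from I have agr: "agree ?A s s'" by blast
    have yxo: "s' ''y'' = s ''y''" "s' ''x'' = s ''x''" "s' ''o'' = s ''o''"
      using agreeD[OF agr, of "''y''"] agreeD[OF agr, of "''x''"] agreeD[OF agr, of "''o''"] by simp_all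
    obtain w us where us: "vs = w # us" using vs(1) p by (cases vs) auto
    then have w: "s ''y'' (s' ''p'' 0) = w" "linked (s ''y'') (s ''x'') (s ''x'' (s' ''p'' 0)) us"
      using vs(1) by simp_all
    have wP: "w \<notin> P" using vs us by auto
    have "wp split_step ?I s' (r + length us * 41 + 3 + 38)"
    proof (rule wp_loop_free[where r = "r + length us * 41 + 3"])
      have "splitting (s ''o'' 0) (s ''C'') (insert w P) (effect split_step s' ''C'')
          (effect split_step s' ''z'') (effect split_step s' ''f'' 0)"
        using splitting_old[OF sp wP] splitting_new[OF sp wP]
        by (cases "s ''o'' 0 < s' ''z'' (s' ''C'' w)") (simp_all add: split_step_def yxo w)
      moreover have "agree ?A s (effect split_step s')"
        using agr by (simp add: split_step_def agree_upd)
      moreover have "effect split_step s' ''p'' 0 = s ''x'' (s' ''p'' 0)"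
        by (simp add: split_step_def yxo)
      ultimately show "?I (effect split_step s') (r + length us * 41 + 3)"
        using vs us w by (intro conjI exI[of _ us] exI[of _ "insert w P"]) auto
    qed (simp_all add: split_step_def)
    then show "\<exists>r''. cost (var ''p'') + 1 + r'' \<le> r' \<and> wp split_step ?I s' r''"
      using vs(5) us by (intro exI[of _ "r + length us * 41 + 3 + 38"]) simp
  qed
qed

context edge_list
begin

text \<open>For \<open>D = {}\<close> there is one single class, matching the zeroed memory; for
  \<open>D = \<Union>E\<close> the classes are those of false twins.\<close>

definition refined :: "nat set \<Rightarrow> mem \<Rightarrow> bool" where
  "refined D s \<longleftrightarrow>
    (\<forall>w w'. s ''C'' w = s ''C'' w' \<longleftrightarrow> nbr E w \<inter> D = nbr E w' \<inter> D) \<and>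
    (\<forall>w. s ''C'' w \<le> s ''f'' 0) \<and> (\<forall>b. s ''z'' b \<le> s ''f'' 0) \<and>
    (\<exists>d. adj_lists (s ''y'') (s ''x'') (s ''h'') d (\<lambda>c. if c \<in> D then {} else nbr E c))"

lemma nbr_mem_iff: "w \<in> nbr E c \<longleftrightarrow> c \<in> nbr E w"
  by (simp add: nbr_def insert_commute)

lemma wp_split_by:
  assumes ref: "refined D s" and c: "val s e = c" "cost e = 3"
  shows "wp (split_by e) (\<lambda>s' r'. r' = r \<and>
      agree {''w'', ''b'', ''f'', ''z'', ''C'', ''p'', ''c'', ''o'', ''h''} s s' \<and> refined (insert c D) s')
    s (r + 41 * card (if c \<in> D then {} else nbr E c) + 21)"
proof -
  let ?A = "{''w'', ''b'', ''f'', ''z'', ''C'', ''p'', ''c'', ''o'', ''h''}"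
  let ?B = "{''w'', ''b'', ''f'', ''z'', ''C'', ''p''}"
  let ?W = "if c \<in> D then {} else nbr E c"
  let ?init = "Seq (assign ''c'' e) (Seq (assign ''o'' (var ''f'')) (assign ''p'' (Cell ''h'' (var ''c''))))"
  let ?s = "effect ?init s"
  have C: "\<And>w w'. s ''C'' w = s ''C'' w' \<longleftrightarrow> nbr E w \<inter> D = nbr E w' \<inter> D"
    and f: "\<And>w. s ''C'' w \<le> s ''f'' 0" and z: "\<And>b. s ''z'' b \<le> s ''f'' 0"
    using ref unfolding refined_def by simp_all
  obtain d where adj: "adj_lists (s ''y'') (s ''x'') (s ''h'') d (\<lambda>c. if c \<in> D then {} else nbr E c)"
    using ref unfolding refined_def by blast
  then obtain ws where ws: "linked (s ''y'') (s ''x'') (s ''h'' c) ws" "distinct ws" "set ws = ?W"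
    unfolding adj_lists_def by blast
  have len: "length ws = card ?W" using ws distinct_card by metis
  have s: "?s ''y'' = s ''y''" "?s ''x'' = s ''x''" "?s ''z'' = s ''z''" "?s ''f'' = s ''f''"
    "?s ''C'' = s ''C''" "?s ''h'' = s ''h''" "?s ''o'' 0 = s ''f'' 0" "?s ''p'' 0 = s ''h'' c" "?s ''c'' 0 = c"
    using c by simp_all
  \<comment> \<open>The 4 units left over pay for emptying the list of \<open>c\<close>.\<close>
  have loop: "wp (While (var ''p'') split_step) (\<lambda>s' r'. r' = r + 4 \<and> agree ?B ?s s' \<and>
      splitting (s ''f'' 0) (s ''C'') ?W (s' ''C'') (s' ''z'') (s' ''f'' 0))
    ?s (r + 4 + length ws * 41 + 3)"
    using wp_split_loop[of ?s ws "r + 4", unfolded s, OF ws(1,2) z refl] ws(3) by simp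
  have post: "refined (insert c D) (effect (Store ''h'' (var ''c'') (Const 0)) s')"
    if agr: "agree ?B ?s s'" and sp: "splitting (s ''f'' 0) (s ''C'') ?W (s' ''C'') (s' ''z'') (s' ''f'' 0)" for s'
  proof -
    have s': "s' ''y'' = s ''y''" "s' ''x'' = s ''x''" "s' ''h'' = s ''h''" "s' ''c'' 0 = c"
      using agreeD[OF agr, of "''y''"] agreeD[OF agr, of "''x''"] agreeD[OF agr, of "''h''"]
        agreeD[OF agr, of "''c''"] s by simp_all
    have C': "\<And>w. s' ''C'' w = (if w \<in> ?W then s' ''z'' (s ''C'' w) else s ''C'' w)"
      and big: "\<And>w. w \<in> ?W \<Longrightarrow> s ''f'' 0 < s' ''z'' (s ''C'' w)"
      and z': "\<And>b. s' ''z'' b \<le> s' ''f'' 0" and ff: "s ''f'' 0 \<le> s' ''f'' 0"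
      and inj: "\<And>b b'. s ''f'' 0 < s' ''z'' b \<Longrightarrow> s' ''z'' b = s' ''z'' b' \<Longrightarrow> b = b'"
      using sp unfolding splitting_def by blast+
    have "s' ''C'' w = s' ''C'' w' \<longleftrightarrow> nbr E w \<inter> insert c D = nbr E w' \<inter> insert c D" for w w'
    proof -
      \<comment> \<open>Moved vertices get numbers above the old \<open>f\<close> and the others
        keep numbers up to it, so the two kinds never share a class. Among moved vertices,
        injectivity of \<open>z\<close> recovers the old class.\<close>
      have "s' ''C'' w = s' ''C'' w' \<longleftrightarrow> s ''C'' w = s ''C'' w' \<and> (w \<in> ?W \<longleftrightarrow> w' \<in> ?W)"
        using big[of w] big[of w'] f[of w] f[of w'] inj[of "s ''C'' w" "s ''C'' w'"] C'[of w] C'[of w']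
        by (cases "w \<in> ?W"; cases "w' \<in> ?W") auto
      also have "\<dots> \<longleftrightarrow> nbr E w \<inter> insert c D = nbr E w' \<inter> insert c D"
        unfolding C using nbr_mem_iff[of w c] nbr_mem_iff[of w' c]
        by (cases "c \<in> D") auto
      finally show ?thesis .
    qed
    moreover have "s' ''C'' w \<le> s' ''f'' 0" for w
      using C'[of w] z'[of "s ''C'' w"] f[of w] ff by (simp split: if_splits)
    moreover have "adj_lists (s ''y'') (s ''x'') ((s ''h'')(c := 0)) d
        (\<lambda>c'. if c' \<in> insert c D then {} else nbr E c')"
      using adj unfolding adj_lists_def by (simp add: linked_Nil_iff)
    ultimately show ?thesis unfolding refined_def using s' z' by auto
  qed
  have agr: "agree ?A s (effect (Store ''h'' (var ''c'') (Const 0)) s')" if "agree ?B ?s s'" for s'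
  proof -
    have "agree ?A s ?s" by (simp add: agree_upd agree_refl)
    from agree_trans[OF this that, of ?A] show ?thesis by (simp add: agree_upd)
  qed
  show ?thesis
    unfolding split_by_def
  proof (intro wp_Seq[of ?init] wp_loop_free[of ?init] wp_Seq[of "While (var ''p'') split_step"])
    show "wp (While (var ''p'') split_step) (wp (Store ''h'' (var ''c'') (Const 0)) (\<lambda>s' r'. r' = r \<and>
      agree ?A s s' \<and> refined (insert c D) s')) ?s (r + 4 + length ws * 41 + 3)"
    proof (rule wp_mono[OF loop])
      fix s' r' assume *: "r' = r + 4 \<and> agree ?B ?s s' \<and>
        splitting (s ''f'' 0) (s ''C'') ?W (s' ''C'') (s' ''z'') (s' ''f'' 0)"
      show "wp (Store ''h'' (var ''c'') (Const 0)) (\<lambda>s' r'. r' = r \<and>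
        agree ?A s s' \<and> refined (insert c D) s') s' r'"
        by (rule wp_loop_free[where r = r]) (use * post agr in simp_all)
    qed simp
  qed (use c len in simp_all)
qed

text \<open>The invariant holds 41 units per arc of the potential, and there are at most
  \<open>2 * m\<close> arcs. Each edge adds 42 for its two calls and 11 for the loop, hence
  \<open>135 = 82 + 42 + 11\<close>.\<close>

lemma wp_refine:
  assumes s: "s ''u'' = uu" "s ''v'' = vv" "s ''m'' 0 = m"
    and zero: "s ''C'' = (\<lambda>_. 0)" "s ''f'' = (\<lambda>_. 0)" "s ''z'' = (\<lambda>_. 0)"
    and adj: "adj_lists (s ''y'') (s ''x'') (s ''h'') d (nbr E)"
  shows "wp refine (\<lambda>s' r'. r' = r \<and>
      agree {''i'', ''w'', ''b'', ''f'', ''z'', ''C'', ''p'', ''c'', ''o'', ''h''} s s' \<and>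
      (\<forall>w w'. s' ''C'' w = s' ''C'' w' \<longleftrightarrow> nbr E w = nbr E w')) s (r + m * 135 + 9)"
proof -
  let ?A = "{''i'', ''w'', ''b'', ''f'', ''z'', ''C'', ''p'', ''c'', ''o'', ''h''}"
  let ?B = "{''w'', ''b'', ''f'', ''z'', ''C'', ''p'', ''c'', ''o'', ''h''}"
  let ?J = "\<lambda>j s' r'. r' = r + 41 * pot (ends j) \<and> agree ?A s s' \<and> refined (ends j) s'"
  have "wp refine (?J m) s (r + 41 * pot (ends 0) + m * (42 + 11) + 9)"
    unfolding refine_def
  proof (rule wp_for_edges[where J = ?J and m = m and b = 42 and r = "r + 41 * pot (ends 0)"])
    show "?J j (s'(''i'' := f)) r' = ?J j s' r'" for j s' f r'
      by (simp add: agree_upd refined_def)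
    show "?J 0 s (r + 41 * pot (ends 0))"
      using zero adj by (auto simp: refined_def agree_refl ends_def)
    fix j s' r' assume j: "j < m" and J: "?J j s' r'" and i: "s' ''i'' 0 = j" "s' ''m'' 0 = m"
    have agr: "agree ?A s s'" and ref: "refined (ends j) s'" using J by blast+
    have uv: "s' ''u'' = uu" "s' ''v'' = vv"
      using s agreeD[OF agr, of "''u''"] agreeD[OF agr, of "''v''"] by simp_all
    let ?r = "r + 41 * pot (ends (Suc j))"
    let ?Wu = "if uu j \<in> ends j then {} else nbr E (uu j)"
    let ?Wv = "if vv j \<in> insert (uu j) (ends j) then {} else nbr E (vv j)"
    have pots: "pot (ends j) = pot (ends (Suc j)) + card ?Wv + card ?Wu"
      using pot_insert[of "ends j" "uu j"] pot_insert[of "insert (uu j) (ends j)" "vv j"]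
      by (simp add: ends_Suc)
    show "wp (Seq (split_by (Cell ''u'' (var ''i''))) (split_by (Cell ''v'' (var ''i''))))
      (\<lambda>s r. s ''i'' 0 = j \<and> s ''m'' 0 = m \<and> ?J (Suc j) s r) s' (r' + 42)"
    proof (rule wp_Seq, rule wp_mono[OF wp_split_by[OF ref, of _ "uu j" "?r + 41 * card ?Wv + 21"]])
      fix s1 r1 assume 1: "r1 = ?r + 41 * card ?Wv + 21 \<and> agree ?B s' s1 \<and> refined (insert (uu j) (ends j)) s1"
      then have agr1: "agree ?B s' s1" by blast
      have s1: "s1 ''v'' = vv" "s1 ''i'' 0 = j" "s1 ''m'' 0 = m"
        using uv i agreeD[OF agr1, of "''v''"] agreeD[OF agr1, of "''i''"] agreeD[OF agr1, of "''m''"] by simp_all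
      show "wp (split_by (Cell ''v'' (var ''i''))) (\<lambda>s r. s ''i'' 0 = j \<and> s ''m'' 0 = m \<and> ?J (Suc j) s r) s1 r1"
      proof (rule wp_mono[OF wp_split_by[of "insert (uu j) (ends j)" s1 _ "vv j" ?r]])
        fix s2 r2 assume 2: "r2 = ?r \<and> agree ?B s1 s2 \<and> refined (insert (vv j) (insert (uu j) (ends j))) s2"
        then have agr2: "agree ?B s1 s2" by blast
        have "agree ?A s s2"
          using agree_trans[OF agree_trans[OF agr agr1, of ?A] agr2, of ?A] by simp
        then show "s2 ''i'' 0 = j \<and> s2 ''m'' 0 = m \<and> ?J (Suc j) s2 r2"
          using 2 s1 agreeD[OF agr2, of "''i''"] agreeD[OF agr2, of "''m''"] by (simp add: ends_Suc)
      qed (use 1 s1 in simp_all)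
    qed (use uv i J pots in simp_all)
  qed (use s in simp_all)
  then show ?thesis
  proof (rule wp_mono)
    fix s' r' assume J: "?J m s' r'"
    have "nbr E w \<inter> ends m = nbr E w" for w using nbr_sub[of w] by (simp add: ends_m Int_absorb2)
    moreover have "pot (ends m) = 0" unfolding pot_def ends_m
      by (simp add: card_eq_0_iff) blast
    ultimately show "r' = r \<and> agree ?A s s' \<and> (\<forall>w w'. s' ''C'' w = s' ''C'' w' \<longleftrightarrow> nbr E w = nbr E w')"
      using J by (auto simp: refined_def)
  qed (use pot_le in \<open>simp add: ends_def\<close>)
qed

end

section \<open>Reduction and output\<close>

context edge_list
begin

text \<open>The array \<open>a\<close> is described twice, as the capped number of visited vertices
  of a class and as the number of kept ones. Equating the two yields the assumption
  \<open>cardK\<close> of the reduction.\<close>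

definition kept :: "nat set \<Rightarrow> nat \<Rightarrow> mem \<Rightarrow> bool" where
  "kept R l s \<longleftrightarrow>
    (\<forall>w. s ''s'' w \<noteq> 0 \<longleftrightarrow> w \<in> R) \<and>
    (\<forall>w. s ''I'' w \<noteq> 0 \<longrightarrow> w \<in> R) \<and>
    (\<forall>x. s ''a'' x = min l (card {w \<in> R. s ''C'' w = x})) \<and>
    (\<forall>x. s ''a'' x = card {w. s ''I'' w \<noteq> 0 \<and> s ''C'' w = x}) \<and>
    bij_betw (s ''I'') {w. s ''I'' w \<noteq> 0} {1..s ''N'' 0} \<and>
    s ''q'' 0 = card (s ''C'' ` R)"

lemma loop_free_keep: "loop_free (keep e)"
  by (simp add: keep_def)

lemma max_cost_keep: "cost e = 3 \<Longrightarrow> max_cost (keep e) = 51"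
  by (simp add: keep_def)

lemma kept_keep:
  assumes K: "kept R l s" and l: "s ''l'' 0 = l" "l \<noteq> 0" and fin: "finite R" and e: "val s e = w"
  shows "kept (insert w R) l (effect (keep e) s)"
proof (cases "w \<in> R")
  case True
  then have "s ''s'' w \<noteq> 0" using K by (simp add: kept_def)
  then have eff: "effect (keep e) s ''C'' = s ''C''" "effect (keep e) s ''s'' = s ''s''"
    "effect (keep e) s ''I'' = s ''I''" "effect (keep e) s ''N'' 0 = s ''N'' 0"
    "effect (keep e) s ''a'' = s ''a''" "effect (keep e) s ''q'' 0 = s ''q'' 0"
    using e by (simp_all add: keep_def)
  have "kept R l (effect (keep e) s)" using K unfolding kept_def eff .
  then show ?thesis using True by (simp add: insert_absorb)
next
  case False
  let ?b = "s ''C'' w"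
  let ?X = "{w' \<in> R. s ''C'' w' = ?b}"
  have s: "\<And>v. s ''s'' v \<noteq> 0 \<longleftrightarrow> v \<in> R" and I: "\<And>v. s ''I'' v \<noteq> 0 \<Longrightarrow> v \<in> R"
    and a: "\<And>x. s ''a'' x = min l (card {w \<in> R. s ''C'' w = x})"
    and aI: "\<And>x. s ''a'' x = card {w. s ''I'' w \<noteq> 0 \<and> s ''C'' w = x}"
    and bij: "bij_betw (s ''I'') {w. s ''I'' w \<noteq> 0} {1..s ''N'' 0}"
    and q: "s ''q'' 0 = card (s ''C'' ` R)"
    using K unfolding kept_def by blast+
  have sw: "s ''s'' w = 0" and Iw: "s ''I'' w = 0" using s I False by blast+
  have new_class: "s ''a'' ?b = 0 \<longleftrightarrow> ?b \<notin> s ''C'' ` R"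
  proof -
    have "s ''a'' ?b = 0 \<longleftrightarrow> card ?X = 0" unfolding a using l(2) by (simp add: min_def)
    also have "\<dots> \<longleftrightarrow> ?X = {}" using fin by simp
    also have "\<dots> \<longleftrightarrow> ?b \<notin> s ''C'' ` R" by (auto simp: image_iff)
    finally show ?thesis .
  qed
  have cardR: "card {v \<in> insert w R. s ''C'' v = x} =
      (if x = ?b then Suc (card ?X) else card {v \<in> R. s ''C'' v = x})" for x
  proof -
    have "{v \<in> insert w R. s ''C'' v = x} = (if x = ?b then insert w ?X else {v \<in> R. s ''C'' v = x})" by auto
    then show ?thesis using fin False by simp
  qed
  have q': "card (s ''C'' ` insert w R) = (if s ''a'' ?b = 0 then Suc (s ''q'' 0) else s ''q'' 0)"
    using q new_class fin by (simp add: insert_absorb)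
  show ?thesis
  proof (cases "s ''a'' ?b < l")
    case True
    let ?n = "Suc (s ''N'' 0)"
    let ?I = "(s ''I'')(w := ?n)"
    have set: "{v. ?I v \<noteq> 0} = insert w {v. s ''I'' v \<noteq> 0}" by auto
    have "bij_betw ?I (insert w {v. s ''I'' v \<noteq> 0}) (insert ?n {1..s ''N'' 0})"
    proof -
      have "bij_betw ?I {v. s ''I'' v \<noteq> 0} {1..s ''N'' 0}"
        using bij by (rule bij_betw_cong[THEN iffD1, rotated]) (use Iw in auto)
      from notIn_Un_bij_betw[OF _ _ this, of w] show ?thesis using Iw by (simp add: Un_insert_right)
    qed
    then have 1: "bij_betw ?I {v. ?I v \<noteq> 0} {1..?n}"
      unfolding set by (simp add: atLeastAtMostSuc_conv)
    have 2: "card {v. ?I v \<noteq> 0 \<and> s ''C'' v = x} = (if x = ?b then Suc (s ''a'' ?b) else s ''a'' x)" for x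
    proof -
      have "{v. ?I v \<noteq> 0 \<and> s ''C'' v = x} = (if x = ?b then insert w {v. s ''I'' v \<noteq> 0 \<and> s ''C'' v = ?b}
         else {v. s ''I'' v \<noteq> 0 \<and> s ''C'' v = x})" by auto
      moreover have "finite {v. s ''I'' v \<noteq> 0 \<and> s ''C'' v = ?b}"
        by (rule finite_subset[OF _ fin]) (use I in auto)
      ultimately show ?thesis using Iw aI by simp
    qed
    have eff: "effect (keep e) s ''C'' = s ''C''" "effect (keep e) s ''s'' = (s ''s'')(w := 1)"
      "effect (keep e) s ''I'' = ?I" "effect (keep e) s ''N'' 0 = ?n"
      "effect (keep e) s ''a'' = (s ''a'')(?b := Suc (s ''a'' ?b))"
      "effect (keep e) s ''q'' 0 = (if s ''a'' ?b = 0 then Suc (s ''q'' 0) else s ''q'' 0)"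
      using sw l True e by (simp_all add: keep_def)
    show ?thesis
      unfolding kept_def eff q' cardR 2
      using 1 s I a True by auto
  next
    case nlt: False
    then have "s ''a'' ?b \<noteq> 0" using l by simp
    then have eff: "effect (keep e) s ''C'' = s ''C''" "effect (keep e) s ''s'' = (s ''s'')(w := 1)"
      "effect (keep e) s ''I'' = s ''I''" "effect (keep e) s ''N'' 0 = s ''N'' 0"
      "effect (keep e) s ''a'' = s ''a''"
      "effect (keep e) s ''q'' 0 = (if s ''a'' ?b = 0 then Suc (s ''q'' 0) else s ''q'' 0)"
      using sw l nlt e by (simp_all add: keep_def)
    show ?thesis
      unfolding kept_def eff q' cardR
      using bij s I a nlt aI by auto
  qed
qed

lemma wp_keep_all:
  assumes s: "s ''u'' = uu" "s ''v'' = vv" "s ''m'' 0 = m" "s ''l'' 0 = l" "l \<noteq> 0"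
    and zero: "s ''s'' = (\<lambda>_. 0)" "s ''a'' = (\<lambda>_. 0)" "s ''q'' = (\<lambda>_. 0)"
      "s ''N'' = (\<lambda>_. 0)" "s ''I'' = (\<lambda>_. 0)"
  shows "wp keep_all (\<lambda>s' r'. r' = r \<and>
      agree {''i'', ''w'', ''b'', ''s'', ''a'', ''q'', ''N'', ''I''} s s' \<and> kept (\<Union>E) l s')
    s (r + m * 113 + 9)"
proof -
  let ?A = "{''i'', ''w'', ''b'', ''s'', ''a'', ''q'', ''N'', ''I''}"
  let ?B = "{''w'', ''b'', ''s'', ''a'', ''q'', ''N'', ''I''}"
  let ?J = "\<lambda>j s' r'. r' = r \<and> agree ?A s s' \<and> kept (ends j) l s'"
  have "wp keep_all (?J m) s (r + m * (102 + 11) + 9)"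
    unfolding keep_all_def
  proof (rule wp_for_edges[where J = ?J and m = m and b = 102 and r = r])
    show "?J j (s'(''i'' := f)) r' = ?J j s' r'" for j s' f r'
      by (simp add: agree_upd kept_def)
    show "?J 0 s r" using zero by (simp add: kept_def agree_refl ends_def bij_betw_def)
    fix j s' r' assume j: "j < m" and J: "?J j s' r'" and i: "s' ''i'' 0 = j" "s' ''m'' 0 = m"
    have agr: "agree ?A s s'" using J by blast
    have uv: "s' ''u'' = uu" "s' ''v'' = vv" "s' ''l'' 0 = l"
      using s agreeD[OF agr, of "''u''"] agreeD[OF agr, of "''v''"] agreeD[OF agr, of "''l''"] by simp_all
    let ?s1 = "effect (keep (Cell ''u'' (var ''i''))) s'"
    let ?s2 = "effect (keep (Cell ''v'' (var ''i''))) ?s1"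
    have agr_keep: "agree ?B s (effect (keep e) s)" for e s
      by (simp add: keep_def agree_upd agree_refl)
    have agr1: "agree ?B s' ?s1" and agr2: "agree ?B ?s1 ?s2" by (rule agr_keep)+
    have agr3: "agree ?B s' ?s2" using agree_trans[OF agr1 agr2, of ?B] by simp
    have agr': "agree ?A s ?s2" using agree_trans[OF agr agr3, of ?A] by simp
    have "kept (insert (uu j) (ends j)) l ?s1"
      using J uv i s(5) by (intro kept_keep finite_ends) simp_all
    then have "kept (insert (vv j) (insert (uu j) (ends j))) l ?s2"
      using uv i s(5) agreeD[OF agr1, of "''v''"] agreeD[OF agr1, of "''i''"] agreeD[OF agr1, of "''l''"]
      by (elim kept_keep) (simp_all add: finite_ends)
    then show "wp (Seq (keep (Cell ''u'' (var ''i''))) (keep (Cell ''v'' (var ''i''))))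
      (\<lambda>s r. s ''i'' 0 = j \<and> s ''m'' 0 = m \<and> ?J (Suc j) s r) s' (r' + 102)"
      using J i agr' agreeD[OF agr3, of "''i''"] agreeD[OF agr3, of "''m''"]
      by (intro wp_loop_free[where r = r]) (simp_all add: ends_Suc loop_free_keep max_cost_keep)
  qed (use s in simp_all)
  then show ?thesis by (rule wp_mono) (simp_all add: ends_m)
qed

end

lemma wp_log_classes:
  assumes q: "s ''q'' 0 = q" "q \<noteq> 0" and zero: "s ''g'' 0 = 0"
  shows "wp log_classes (\<lambda>s' r'. r' = r \<and> agree {''j'', ''r'', ''g''} s s' \<and>
      2 ^ s' ''g'' 0 \<le> q \<and> q < 2 ^ Suc (s' ''g'' 0)) s (r + q * 29 + 12)"
proof -
  let ?A = "{''j'', ''r'', ''g''}"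
  let ?I = "\<lambda>s' r'. agree ?A s s' \<and> s' ''j'' 0 \<noteq> 0 \<and> s' ''j'' 0 \<le> q \<and>
     s' ''r'' 0 + s' ''j'' 0 = 2 ^ Suc (s' ''g'' 0) \<and> s' ''r'' 0 \<noteq> 0 \<and> s' ''r'' 0 \<le> 2 ^ s' ''g'' 0 \<and>
     r' = r + (q - s' ''j'' 0) * 29 + 6"
  let ?e = "Monus (var ''q'') (var ''j'')"
  let ?c = "Seq (assign ''j'' (Inc (var ''j'')))
      (Seq (assign ''r'' (Monus (var ''r'') (Const 1)))
           (If (var ''r'') Skip
             (Seq (assign ''r'' (var ''j'')) (assign ''g'' (Inc (var ''g''))))))"
  let ?s = "effect (Seq (assign ''j'' (Const 1)) (assign ''r'' (Const 1))) s"
  show ?thesis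
    unfolding log_classes_def
  proof (rule wp_Seq, rule wp_loop_free)
    show "wp (While ?e ?c) (\<lambda>s' r'. r' = r \<and> agree ?A s s' \<and>
      2 ^ s' ''g'' 0 \<le> q \<and> q < 2 ^ Suc (s' ''g'' 0)) ?s (r + (q - 1) * 29 + 6)"
    proof (rule wp_While[where I = ?I])
      fix s' r' assume I: "?I s' r'" and ne: "val s' ?e \<noteq> 0"
      from I have agr: "agree ?A s s'" by blast
      have q': "s' ''q'' 0 = q" using q agreeD[OF agr, of "''q''"] by simp
      then have lt: "s' ''j'' 0 < q" using ne by simp
      \<comment> \<open>If \<open>r\<close> drops to 0, then \<open>j\<close> has reached
        \<open>2 ^ (g + 1)\<close>; resetting \<open>r\<close> to \<open>j\<close> restores the
        invariant for \<open>g + 1\<close>.\<close>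
      have "wp ?c ?I s' (r + (q - Suc (s' ''j'' 0)) * 29 + 6 + 23)"
        by (rule wp_loop_free[where r = "r + (q - Suc (s' ''j'' 0)) * 29 + 6"])
          (use I lt in \<open>auto simp: agree_upd\<close>)
      moreover have "cost ?e + 1 + (r + (q - Suc (s' ''j'' 0)) * 29 + 6 + 23) \<le> r'"
        using I lt by simp
      ultimately show "\<exists>r''. cost ?e + 1 + r'' \<le> r' \<and> wp ?c ?I s' r''" by blast
    next
      fix s' r' assume I: "?I s' r'" and ne: "val s' ?e = 0"
      from I have agr: "agree ?A s s'" by blast
      have "s' ''q'' 0 = q" using q agreeD[OF agr, of "''q''"] by simp
      then have "s' ''j'' 0 = q" using ne I by simp
      \<comment> \<open>With \<open>j = q\<close>, the bounds \<open>0 < r \<le> 2 ^ g\<close> turn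
        \<open>r + q = 2 ^ (g + 1)\<close> into both inequalities.\<close>
      then show "\<exists>r''. cost ?e + 1 + r'' \<le> r' \<and> r'' = r \<and> agree ?A s s' \<and>
        2 ^ s' ''g'' 0 \<le> q \<and> q < 2 ^ Suc (s' ''g'' 0)"
        using I by auto
    qed (use q zero in \<open>auto simp: agree_upd agree_refl\<close>)
  qed (use q in simp_all)
qed

lemma bij_betw_extend:
  assumes "bij_betw g {..<n} X" "x \<notin> X" "\<And>i. i < n \<Longrightarrow> h i = g i" "h n = x"
  shows "bij_betw h {..<Suc n} (insert x X)"
proof -
  have "bij_betw h {..<n} X"
    using assms(1) by (rule bij_betw_cong[THEN iffD1, rotated]) (use assms(3) in simp)
  from notIn_Un_bij_betw[OF _ _ this, of n] show ?thesis
    using assms(2,4) by (simp add: lessThan_Suc)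
qed

context edge_list
begin

lemma wp_output_kept:
  fixes s :: mem
  defines "K \<equiv> {w. s ''I'' w \<noteq> 0}" and "f \<equiv> \<lambda>w. s ''I'' w - 1"
  assumes s: "s ''u'' = uu" "s ''v'' = vv" "s ''m'' 0 = m" "s ''M'' = (\<lambda>_. 0)"
    and inj: "inj_on f K"
  shows "wp output_kept (\<lambda>s' r'. r' = r \<and> s' ''n'' 0 = s ''N'' 0 \<and>
      s' ''k'' 0 = s' ''m'' 0 - s ''l'' 0 \<and>
      bij_betw (\<lambda>k. {s' ''u'' k, s' ''v'' k}) {..<s' ''m'' 0} ((`) f ` {e \<in> E. e \<subseteq> K}))
    s (r + m * 44 + 24)"
proof -
  let ?A = "{''i'', ''u'', ''v'', ''M''}"
  let ?X = "\<lambda>j. (`) f ` {e \<in> (\<lambda>k. {uu k, vv k}) ` {..<j}. e \<subseteq> K}"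
  \<comment> \<open>The 15 units are reserved for the three assignments after the loop.\<close>
  let ?J = "\<lambda>j s' r'. r' = r + 15 \<and> agree ?A s s' \<and> s' ''M'' 0 \<le> j \<and>
    (\<forall>k\<ge>j. s' ''u'' k = uu k \<and> s' ''v'' k = vv k) \<and>
    bij_betw (\<lambda>k. {s' ''u'' k, s' ''v'' k}) {..<s' ''M'' 0} (?X j)"
  have loop: "wp (for_edges copy_edge) (?J m) s (r + 15 + m * (33 + 11) + 9)"
  proof (rule wp_for_edges[where J = ?J and m = m and b = 33 and r = "r + 15"])
    show "?J j (s'(''i'' := h)) r' = ?J j s' r'" for j s' h r' by (simp add: agree_upd)
    show "?J 0 s (r + 15)" using s by (simp add: agree_refl bij_betw_def)
    fix j s' r' assume j: "j < m" and J: "?J j s' r'" and i: "s' ''i'' 0 = j" "s' ''m'' 0 = m"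
    let ?e = "{uu j, vv j}"
    from J have agr: "agree ?A s s'" and M: "s' ''M'' 0 \<le> j"
      and uv: "\<And>k. j \<le> k \<Longrightarrow> s' ''u'' k = uu k \<and> s' ''v'' k = vv k"
      and bij: "bij_betw (\<lambda>k. {s' ''u'' k, s' ''v'' k}) {..<s' ''M'' 0} (?X j)"
      by blast+
    have I: "s' ''I'' = s ''I''" using agreeD[OF agr, of "''I''"] by simp
    let ?t = "effect copy_edge s'"
    have "?J (Suc j) ?t r'"
    proof (cases "?e \<subseteq> K")
      case True
      have I0: "s ''I'' (uu j) \<noteq> 0" "s ''I'' (vv j) \<noteq> 0" using True by (simp_all add: K_def)
      \<comment> \<open>Distinct edges inside \<open>K\<close> stay distinct under the renaming, so
        the output list is repetition-free.\<close>
      have new: "f ` ?e \<notin> ?X j"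
      proof
        assume "f ` ?e \<in> ?X j"
        then obtain k where k: "k < j" "{uu k, vv k} \<subseteq> K" "f ` ?e = f ` {uu k, vv k}" by auto
        then have "?e = {uu k, vv k}" using inj_on_image_eq_iff[OF inj True] by blast
        then show False using edge_inj[of j k] j k(1) by simp
      qed
      have "{e \<in> (\<lambda>k. {uu k, vv k}) ` {..<Suc j}. e \<subseteq> K} =
          insert ?e {e \<in> (\<lambda>k. {uu k, vv k}) ` {..<j}. e \<subseteq> K}"
        using True by (auto simp: lessThan_Suc)
      then have X: "?X (Suc j) = insert (f ` ?e) (?X j)" by simp
      have t: "?t ''M'' 0 = Suc (s' ''M'' 0)" "agree ?A s ?t"
        "?t ''u'' = (s' ''u'')(s' ''M'' 0 := f (uu j))" "?t ''v'' = (s' ''v'')(s' ''M'' 0 := f (vv j))"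
        using agr I0 i uv[of j] I by (simp_all add: copy_edge_def f_def agree_upd)
      have "bij_betw (\<lambda>k. {?t ''u'' k, ?t ''v'' k}) {..<Suc (s' ''M'' 0)} (insert (f ` ?e) (?X j))"
        by (rule bij_betw_extend[OF bij new]) (simp_all add: t)
      then show ?thesis unfolding X t(1) using t M J uv by simp
    next
      case False
      then have X: "?X (Suc j) = ?X j" by (auto simp: lessThan_Suc)
      have "s ''I'' (uu j) = 0 \<or> s ''I'' (vv j) = 0" using False by (auto simp: K_def)
      then have t: "?t = s'" using i uv[of j] I by (auto simp: copy_edge_def)
      show ?thesis unfolding X t using J by auto
    qed
    moreover have "?t ''i'' 0 = j" "?t ''m'' 0 = m" using i by (simp_all add: copy_edge_def)
    ultimately show "wp copy_edge (\<lambda>s r. s ''i'' 0 = j \<and> s ''m'' 0 = m \<and> ?J (Suc j) s r) s' (r' + 33)"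
      by (intro wp_loop_free[where r = r']) (simp_all add: copy_edge_def del: effect.simps)
  qed (use s in simp_all)
  show ?thesis
    unfolding output_kept_def
  proof (rule wp_Seq, rule wp_mono[OF loop])
    fix s' r' assume J: "?J m s' r'"
    then have agr: "agree ?A s s'" by blast
    have "?X m = (`) f ` {e \<in> E. e \<subseteq> K}" unfolding E_eq ..
    then show "wp (Seq (assign ''n'' (var ''N''))
      (Seq (assign ''m'' (var ''M'')) (assign ''k'' (Monus (var ''M'') (var ''l'')))))
      (\<lambda>s' r'. r' = r \<and> s' ''n'' 0 = s ''N'' 0 \<and>
      s' ''k'' 0 = s' ''m'' 0 - s ''l'' 0 \<and>
      bij_betw (\<lambda>k. {s' ''u'' k, s' ''v'' k}) {..<s' ''m'' 0} ((`) f ` {e \<in> E. e \<subseteq> K})) s' r'"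
      by (intro wp_loop_free[where r = r])
        (use J agreeD[OF agr, of "''N''"] agreeD[OF agr, of "''l''"] in simp_all)
  qed simp
qed

end

section \<open>Correctness and cost of the whole program\<close>

definition kernel_of :: "nat set set \<Rightarrow> nat \<Rightarrow> mem \<Rightarrow> bool" where
  "kernel_of E k s \<longleftrightarrow> (\<exists>V' E' k'. simple_graph V' E' \<and> encodes s V' E' k' \<and> (STC E k \<longleftrightarrow> STC E' k') \<and>
     ell E' k' \<le> ell E k \<and> card V' \<le> 4 * (ell E k * 2 ^ ell E k))"

text \<open>The empty graph with budget 0 is a yes-instance with parameter 0 and no vertices, so it
  meets every bound.\<close>

lemma wp_output_yes:
  assumes "STC E k" "9 \<le> r"
  shows "wp output_yes (\<lambda>s' r'. kernel_of E k s') s r"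
proof (rule wp_loop_free[where r = 0])
  let ?s = "effect output_yes s"
  have "STC {} 0" unfolding STC_def stc_labeling_def by auto
  moreover have "encodes ?s {} {} 0" by (simp add: encodes_def output_yes_def bij_betw_def)
  moreover have "simple_graph {} {}" by (simp add: simple_graph_def)
  ultimately show "kernel_of E k ?s"
    unfolding kernel_of_def using assms(1)
    by (intro exI[of _ "{}"] exI[of _ 0]) (simp add: ell_def)
qed (use assms(2) in \<open>simp_all add: output_yes_def\<close>)

lemma (in edge_list) inj_on_kept_index:
  assumes "kept R l s"
  shows "inj_on (\<lambda>w. s ''I'' w - 1) {w. s ''I'' w \<noteq> 0}"
proof (rule inj_onI)
  fix w w' assume w: "w \<in> {w. s ''I'' w \<noteq> 0}" "w' \<in> {w. s ''I'' w \<noteq> 0}"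
    and "s ''I'' w - 1 = s ''I'' w' - 1"
  \<comment> \<open>Both indices are nonzero, so subtracting 1 is not truncated.\<close>
  then have "s ''I'' w = s ''I'' w'" by simp
  moreover have "inj_on (s ''I'') {w. s ''I'' w \<noteq> 0}"
    using assms unfolding kept_def bij_betw_def by blast
  ultimately show "w = w'" using w by (simp only: inj_on_eq_iff)
qed

lemma (in edge_list) kernel_of_output:
  fixes s :: mem
  defines "K \<equiv> {w. s ''I'' w \<noteq> 0}" and "f \<equiv> \<lambda>w. s ''I'' w - 1"
  assumes l: "l = ell E k" "l \<noteq> 0"
    and C: "\<And>w w'. s ''C'' w = s ''C'' w' \<longleftrightarrow> nbr E w = nbr E w'"
    and kept: "kept (\<Union>E) l s"
    and few: "s ''q'' 0 < 2 ^ Suc (Suc l)"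
    and out: "s' ''n'' 0 = s ''N'' 0" "s' ''k'' 0 = s' ''m'' 0 - l"
      "bij_betw (\<lambda>k. {s' ''u'' k, s' ''v'' k}) {..<s' ''m'' 0} ((`) f ` {e \<in> E. e \<subseteq> K})"
  shows "kernel_of E k s'"
proof -
  have bij: "bij_betw (s ''I'') K {1..s ''N'' 0}" and KE: "K \<subseteq> \<Union>E"
    and a: "\<And>x. card {w \<in> K. s ''C'' w = x} = min l (card {w \<in> \<Union>E. s ''C'' w = x})"
    and q: "s ''q'' 0 = card (s ''C'' ` \<Union>E)"
    using kept unfolding kept_def K_def by (auto simp del: Union_iff)
  have inj: "inj_on f K" unfolding f_def K_def using kept by (rule inj_on_kept_index)
  interpret twin_reduction E K l "s ''C''" f
    by unfold_locales (use finite_E two C KE a inj in auto)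
  let ?k = "s' ''m'' 0 - l"
  have m': "s' ''m'' 0 = card kern"
    using bij_betw_same_card[OF out(3)] by (simp add: kern_def)
  have "l \<le> card E" using l by (simp add: ell_def)
  then have le: "l \<le> card kern" using card_kern_ge l(2) by simp
  then have ell: "ell kern ?k = l" by (simp add: ell_def m')
  have fN: "f w < s ''N'' 0" if "w \<in> K" for w
  proof -
    have "s ''I'' w \<in> {1..s ''N'' 0}" using bij that by (rule bij_betwE[rule_format])
    then show ?thesis by (auto simp: f_def)
  qed
  have finK: "finite K" using KE finite_Union finite_subset by blast
  have "simple_graph {..<s ''N'' 0} kern"
    unfolding simple_graph_def kern_def
    using fN two card_image[OF inj_on_subset[OF inj]] by auto
  moreover have "encodes s' {..<s ''N'' 0} kern ?k"
    using out by (simp add: encodes_def kern_def)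
  moreover have "STC E k \<longleftrightarrow> STC kern ?k"
    using STC_iff_has_strong[OF finite_E, of k] has_strong_kern ell l(1)
      STC_iff_has_strong[of kern ?k] finite_E by (simp add: kern_def)
  moreover have "card {..<s ''N'' 0} \<le> 4 * (l * 2 ^ l)"
  proof -
    have "s ''N'' 0 = card K" using bij_betw_same_card[OF bij] by simp
    also have "\<dots> \<le> s ''q'' 0 * l" using card_kept_le q by simp
    \<comment> \<open>The source of the constant 4: fewer than \<open>2 ^ (l + 2)\<close> classes
      with at most \<open>l\<close> kept vertices each.\<close>
    also have "\<dots> \<le> 2 ^ Suc (Suc l) * l" using few by (intro mult_right_mono) simp_all
    finally show ?thesis by (simp add: mult_ac)
  qed
  ultimately show "kernel_of E k s'"
    unfolding kernel_of_def using ell l(1) by (intro exI[of _ "{..<s ''N'' 0}"] exI[of _ kern] exI[of _ ?k]) simp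
qed

text \<open>Per edge the five passes cost 59, 135, 113, 58 and 44, together 409; the constants 500
  and 100 are rounded up.\<close>

lemma wp_kernelize:
  assumes G: "simple_graph V E" and init: "initial s V E k"
  shows "wp kernelize (\<lambda>s' r'. kernel_of E k s') s (card E * 500 + 100)"
proof -
  let ?m = "s ''m'' 0"
  have enc: "bij_betw (\<lambda>i. {s ''u'' i, s ''v'' i}) {..<?m} E" "s ''k'' 0 = k"
    using init by (simp_all add: initial_def encodes_def)
  interpret edge_list "s ''u''" "s ''v''" ?m E
    using enc(1) G by unfold_locales (auto simp: simple_graph_def)
  \<comment> \<open>Every working array starts out as zero, so no pass over the vertices is needed
    to initialize it.\<close>
  have zero: "s a = (\<lambda>_. 0)" if "a \<notin> {''n'', ''m'', ''k'', ''u'', ''v''}" for a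
    using init that unfolding initial_def by (intro ext) blast
  define l where "l = ell E k"
  have l: "?m - k = l" using card_E by (simp add: l_def ell_def)
  let ?Q = "\<lambda>s' r'. kernel_of E k s'"
  let ?s1 = "effect (assign ''l'' (Monus (var ''m'') (var ''k''))) s"
  have l1: "?s1 ''l'' 0 = l" using l enc(2) by simp
  have agr1: "agree {''l''} s ?s1" by (simp add: agree_upd agree_refl)
  have yes: "STC E k" if "has_strong E l" using that STC_iff_has_strong[OF finite_E] l_def by simp
  have main: "wp (Seq link_edges (Seq refine (Seq keep_all (Seq log_classes
        (If (Monus (var ''g'') (Inc (var ''l''))) output_yes output_kept))))) ?Q ?s1
        (?m * 409 + 80)" if "l \<noteq> 0"
  proof (rule wp_Seq, rule wp_mono[OF wp_link_edges[where r = "?m * 350 + 71"]])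
    have "?s1 ''u'' = s ''u''" "?s1 ''v'' = s ''v''" "?s1 ''m'' 0 = ?m" "?s1 ''h'' = (\<lambda>_. 0)"
      using zero[of "''h''"] by simp_all
    then show "?s1 ''u'' = s ''u''" "?s1 ''v'' = s ''v''" "?s1 ''m'' 0 = ?m" "?s1 ''h'' = (\<lambda>_. 0)" .
    fix s2 r2 assume 2: "r2 = ?m * 350 + 71 \<and> agree {''i'', ''d'', ''h'', ''y'', ''x''} ?s1 s2 \<and>
      (\<exists>d. adj_lists (s2 ''y'') (s2 ''x'') (s2 ''h'') d (nbr E))"
    then obtain d where adj: "adj_lists (s2 ''y'') (s2 ''x'') (s2 ''h'') d (nbr E)" by blast
    let ?A2 = "{''l'', ''i'', ''d'', ''h'', ''y'', ''x''}"
    have agr: "agree {''i'', ''d'', ''h'', ''y'', ''x''} ?s1 s2" using 2 by blast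
    have agr2: "agree ?A2 s s2" using agree_trans[OF agr1 agr, of ?A2] by simp
    have s2: "s2 ''u'' = s ''u''" "s2 ''v'' = s ''v''" "s2 ''m'' 0 = ?m" "s2 ''C'' = (\<lambda>_. 0)"
      "s2 ''f'' = (\<lambda>_. 0)" "s2 ''z'' = (\<lambda>_. 0)" "s2 ''l'' 0 = l"
      using zero[of "''C''"] zero[of "''f''"] zero[of "''z''"] agreeD[OF agr2, of "''u''"]
        agreeD[OF agr2, of "''v''"] agreeD[OF agr2, of "''m''"] agreeD[OF agr2, of "''C''"]
        agreeD[OF agr2, of "''f''"] agreeD[OF agr2, of "''z''"] agreeD[OF agr, of "''l''"] l1
      by simp_all
    show "wp (Seq refine (Seq keep_all (Seq log_classes
        (If (Monus (var ''g'') (Inc (var ''l''))) output_yes output_kept)))) ?Q s2 r2"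
    proof (rule wp_Seq, rule wp_mono[OF wp_refine[OF s2(1-6) adj, where r = "?m * 215 + 62"]])
      let ?B3 = "{''i'', ''w'', ''b'', ''f'', ''z'', ''C'', ''p'', ''c'', ''o'', ''h''}"
      fix s3 r3 assume 3: "r3 = ?m * 215 + 62 \<and> agree ?B3 s2 s3 \<and>
        (\<forall>w w'. s3 ''C'' w = s3 ''C'' w' \<longleftrightarrow> nbr E w = nbr E w')"
      then have agr: "agree ?B3 s2 s3" by blast
      let ?A3 = "{''l'', ''i'', ''d'', ''h'', ''y'', ''x'', ''w'', ''b'', ''f'', ''z'', ''C'', ''p'', ''c'', ''o''}"
      have agr3: "agree ?A3 s s3" using agree_trans[OF agr2 agr, of ?A3] by simp
      have s3: "s3 ''u'' = s ''u''" "s3 ''v'' = s ''v''" "s3 ''m'' 0 = ?m" "s3 ''l'' 0 = l"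
        using agreeD[OF agr3, of "''u''"] agreeD[OF agr3, of "''v''"] agreeD[OF agr3, of "''m''"]
          agreeD[OF agr, of "''l''"] s2 by simp_all
      have z3: "s3 ''s'' = (\<lambda>_. 0)" "s3 ''a'' = (\<lambda>_. 0)" "s3 ''q'' = (\<lambda>_. 0)"
        "s3 ''N'' = (\<lambda>_. 0)" "s3 ''I'' = (\<lambda>_. 0)" "s3 ''g'' = (\<lambda>_. 0)" "s3 ''M'' = (\<lambda>_. 0)"
        using agreeD[OF agr3, of "''s''"] agreeD[OF agr3, of "''a''"] agreeD[OF agr3, of "''q''"]
          agreeD[OF agr3, of "''N''"] agreeD[OF agr3, of "''I''"] agreeD[OF agr3, of "''g''"]
          agreeD[OF agr3, of "''M''"] zero[of "''s''"] zero[of "''a''"] zero[of "''q''"]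
          zero[of "''N''"] zero[of "''I''"] zero[of "''g''"] zero[of "''M''"]
        by simp_all
      show "wp (Seq keep_all (Seq log_classes
        (If (Monus (var ''g'') (Inc (var ''l''))) output_yes output_kept))) ?Q s3 r3"
      proof (rule wp_Seq, rule wp_mono[OF wp_keep_all[OF s3 \<open>l \<noteq> 0\<close> z3(1-5), where r = "?m * 102 + 53"]])
        let ?B4 = "{''i'', ''w'', ''b'', ''s'', ''a'', ''q'', ''N'', ''I''}"
        fix s4 r4 assume 4: "r4 = ?m * 102 + 53 \<and> agree ?B4 s3 s4 \<and> kept (\<Union>E) l s4"
        then have agr4: "agree ?B4 s3 s4" and kept: "kept (\<Union>E) l s4" by blast+
        have s4: "s4 ''u'' = s ''u''" "s4 ''v'' = s ''v''" "s4 ''m'' 0 = ?m" "s4 ''l'' 0 = l"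
          "s4 ''g'' 0 = 0" "s4 ''M'' = (\<lambda>_. 0)" "s4 ''C'' = s3 ''C''"
          using agreeD[OF agr4, of "''u''"] agreeD[OF agr4, of "''v''"] agreeD[OF agr4, of "''m''"]
            agreeD[OF agr4, of "''l''"] agreeD[OF agr4, of "''g''"] agreeD[OF agr4, of "''M''"]
            agreeD[OF agr4, of "''C''"] s3 z3 by simp_all
        let ?q = "s4 ''q'' 0"
        have C: "s4 ''C'' w = s4 ''C'' w' \<longleftrightarrow> nbr E w = nbr E w'" for w w'
          using 3 s4(7) by simp
        have q: "?q = card (s4 ''C'' ` \<Union>E)" using kept by (simp add: kept_def)
        have finU: "finite (\<Union>E)" using finite_ends[of ?m] by (simp add: ends_m)
        have "?q \<le> card (\<Union>E)" unfolding q using finU by (rule card_image_le)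
        \<comment> \<open>Only classes of endpoints of edges are counted, so counting up to
          \<open>q\<close> stays linear in \<open>m\<close>.\<close>
        then have qm: "?q \<le> 2 * ?m" using card_ends[of ?m] by (simp add: ends_m)
        have "0 < ?m" using \<open>l \<noteq> 0\<close> l by simp
        then have "\<Union>E \<noteq> {}" using edge[of 0] by blast
        then have q0: "?q \<noteq> 0" unfolding q using finU by simp
        show "wp (Seq log_classes
          (If (Monus (var ''g'') (Inc (var ''l''))) output_yes output_kept)) ?Q s4 r4"
        proof (rule wp_Seq, rule wp_mono[OF wp_log_classes[where r = "?m * 44 + 31" and q = ?q]])
          fix s5 r5 assume 5: "r5 = ?m * 44 + 31 \<and> agree {''j'', ''r'', ''g''} s4 s5 \<and>
            2 ^ s5 ''g'' 0 \<le> ?q \<and> ?q < 2 ^ Suc (s5 ''g'' 0)"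
          then have agr5: "agree {''j'', ''r'', ''g''} s4 s5" by blast
          have s5: "s5 ''u'' = s ''u''" "s5 ''v'' = s ''v''" "s5 ''m'' 0 = ?m" "s5 ''M'' = (\<lambda>_. 0)"
            "s5 ''l'' 0 = l" "s5 ''q'' = s4 ''q''" "s5 ''C'' = s4 ''C''" "s5 ''I'' = s4 ''I''"
            "s5 ''N'' = s4 ''N''" "s5 ''s'' = s4 ''s''" "s5 ''a'' = s4 ''a''"
            using agreeD[OF agr5, of "''u''"] agreeD[OF agr5, of "''v''"] agreeD[OF agr5, of "''m''"]
              agreeD[OF agr5, of "''M''"] agreeD[OF agr5, of "''l''"] agreeD[OF agr5, of "''q''"]
              agreeD[OF agr5, of "''C''"] agreeD[OF agr5, of "''I''"] agreeD[OF agr5, of "''N''"]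
              agreeD[OF agr5, of "''s''"] agreeD[OF agr5, of "''a''"] s4 by simp_all
          have C5: "s5 ''C'' w = s5 ''C'' w' \<longleftrightarrow> nbr E w = nbr E w'" for w w'
            using C s5(7) by simp
          have kept5: "kept (\<Union>E) l s5" using kept unfolding kept_def s5 .
          show "wp (If (Monus (var ''g'') (Inc (var ''l''))) output_yes output_kept) ?Q s5 r5"
          proof (rule wp_If[where r = "?m * 44 + 24"])
            assume "val s5 (Monus (var ''g'') (Inc (var ''l''))) \<noteq> 0"
            then have "Suc (Suc l) \<le> s5 ''g'' 0" using s5(5) by simp
            \<comment> \<open>This many classes exceed the \<open>2 ^ (l + 1)\<close> that are
              possible without \<open>l\<close> strong edges.\<close>
            then have "(2::nat) ^ Suc (Suc l) \<le> 2 ^ s5 ''g'' 0" by (rule power_increasing) simp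
            also have "\<dots> \<le> card (s4 ''C'' ` \<Union>E)" using 5 q by simp
            also have "\<dots> \<le> card (nbr E ` \<Union>E)"
              using finU by (rule card_image_le_card_image) (simp add: C)
            finally have "2 ^ Suc (Suc l) \<le> card (nbr E ` \<Union>E)" .
            moreover have "(2::nat) ^ Suc l < 2 ^ Suc (Suc l)" by simp
            ultimately have "\<not> card (nbr E ` \<Union>E) \<le> 2 ^ Suc l" by linarith
            then have "has_strong E l" using card_nbr_classes_le[OF finite_E two] by blast
            then show "wp output_yes ?Q s5 (?m * 44 + 24)" by (intro wp_output_yes yes) simp_all
          next
            assume "val s5 (Monus (var ''g'') (Inc (var ''l''))) = 0"
            then have "s5 ''g'' 0 \<le> Suc l" using s5(5) by simp
            then have "(2::nat) ^ Suc (s5 ''g'' 0) \<le> 2 ^ Suc (Suc l)" by (intro power_increasing) simp_all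
            moreover have "s5 ''q'' 0 < 2 ^ Suc (s5 ''g'' 0)" using 5 unfolding s5(6) by blast
            ultimately have few: "s5 ''q'' 0 < 2 ^ Suc (Suc l)" by (rule less_le_trans[rotated])
            note kern = kernel_of_output[OF l_def \<open>l \<noteq> 0\<close> C5 kept5 few]
            show "wp output_kept ?Q s5 (?m * 44 + 24)"
            proof (rule wp_mono[OF wp_output_kept[OF s5(1-4), where r = 0]])
              show "inj_on (\<lambda>w. s5 ''I'' w - 1) {w. s5 ''I'' w \<noteq> 0}"
                using kept5 by (rule inj_on_kept_index)
            qed (use kern s5(5) in simp_all)
          qed (use 5 in simp_all)
        qed (use 4 s4 q0 qm in simp_all)
      qed (use 3 in simp)
    qed (use 2 in simp)
  qed simp
  show ?thesis
    unfolding kernelize_def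
  proof (rule wp_Seq, rule wp_loop_free)
    show "wp (If (var ''l'') (Seq link_edges (Seq refine (Seq keep_all (Seq log_classes
        (If (Monus (var ''g'') (Inc (var ''l''))) output_yes output_kept))))) output_yes)
      ?Q ?s1 (?m * 409 + 83)"
    proof (rule wp_If)
      assume "val ?s1 (var ''l'') \<noteq> 0"
      then have "l \<noteq> 0" using l1 by simp
      then show "wp (Seq link_edges (Seq refine (Seq keep_all (Seq log_classes
        (If (Monus (var ''g'') (Inc (var ''l''))) output_yes output_kept))))) ?Q ?s1 (?m * 409 + 80)"
        by (rule main)
    next
      assume "val ?s1 (var ''l'') = 0"
      then have "l = 0" using l1 by simp
      moreover have "strong_set E {}" by (simp add: strong_set_def)
      ultimately have "has_strong E l" unfolding has_strong_def by (intro exI[of _ "{}"]) simp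
      then show "wp output_yes ?Q ?s1 (?m * 409 + 80)" by (intro wp_output_yes yes) simp_all
    qed simp
  qed (simp_all add: card_E)
qed

theorem theorem2:
  "\<exists>p g c. g \<in> O(\<lambda>l. real l * 2 ^ l) \<and> stc_kernel p g (sqrt_time c)"
proof (intro exI conjI)
  let ?g = "\<lambda>l. 4 * (real l * 2 ^ l)"
  show "?g \<in> O(\<lambda>l. real l * 2 ^ l)" by simp
  show "stc_kernel kernelize ?g (sqrt_time 600)"
    unfolding stc_kernel_def
  proof (intro allI impI)
    fix V E k s assume *: "simple_graph V E \<and> initial s V E k"
    then obtain t s' r' where t: "exec kernelize s t s'" "t + r' \<le> card E * 500 + 100"
      and "kernel_of E k s'"
      using wp_kernelize[of V E s k] unfolding wp_def by blast
    then obtain V' E' k' where K: "simple_graph V' E'" "encodes s' V' E' k'" "STC E k \<longleftrightarrow> STC E' k'"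
      "ell E' k' \<le> ell E k" "card V' \<le> 4 * (ell E k * 2 ^ ell E k)"
      unfolding kernel_of_def by blast
    \<comment> \<open>An edge forces a vertex, so \<open>sqrt n\<close> is at least 1 and linear
      time is within the bound; without edges both sides are 0.\<close>
    have "real (card E) \<le> sqrt (real (card V)) * real (card E)"
    proof (cases "E = {}")
      case False
      then obtain e where "e \<in> E" by blast
      then have "e \<subseteq> V" "card e = 2" "finite V" using * by (auto simp: simple_graph_def)
      then have "1 \<le> card V" using card_mono[of V e] by simp
      then have "1 \<le> sqrt (real (card V))" by simp
      then show ?thesis by (simp add: mult_le_cancel_right1)
    qed simp
    then have "real (card E) \<le> max 1 (sqrt (real (card V)) * real (card E))" by simp
    moreover have "real t \<le> real (card E) * 500 + 100"
      using t(2) by linarith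
    \<comment> \<open>Both \<open>card E\<close> and 1 are at most the maximum, whence
      \<open>600 = 500 + 100\<close>.\<close>
    ultimately have "real t \<le> sqrt_time 600 (card V) (card E)"
      unfolding sqrt_time_def by (smt (verit) max.cobounded1)
    moreover have "real (card V') \<le> ?g (ell E k)"
      using K(5)[folded of_nat_le_iff[where 'a = real]] by simp
    ultimately show "\<exists>t s' V' E' k'. exec kernelize s t s' \<and> real t \<le> sqrt_time 600 (card V) (card E) \<and>
        simple_graph V' E' \<and> encodes s' V' E' k' \<and> (STC E k \<longleftrightarrow> STC E' k') \<and>
        ell E' k' \<le> ell E k \<and> real (card V') \<le> ?g (ell E k)"
      using t(1) K by blast
  qed
qed

end
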